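(* For every real $\varepsilon > 0$ and every integer $k \geq 2$ there is a constant $C = C(\varepsilon,k) > 0$ such that the following holds for all sufficiently large (depending on $\varepsilon$ and $k$) $\Delta\in\mathbb{N}$. For every integer $n \geq C\,\Delta^{5+1/(k-1)}\log\Delta$ and every $n$-balanced $k$-uniform $k$-partite hypergraph $H$ of maximum degree $\Delta$, $$\chi_b(H) \leq \left((k-1+\varepsilon)\frac{\Delta}{\log\Delta}\right)^{1/(k-1)}.$$
   Context: Hypergraphs are finite and undirected. A hypergraph $H=(V,E)$ is $k$-uniform if every edge is a $k$-element subset of $V$. A $k$-uniform hypergraph is $k$-partite if $V$ comes with a partition $V = V_1\cup\cdots\cup V_k$ such that $|e\cap V_i| = 1$ for every edge $e$ and every $i\in[k]=\{1,\dots,k\}$; it is $n$-balanced if moreover $|V_i| = n$ for each $i$. The degree $\deg_H(v)$ is the number of edges containing $v$, and the maximum degree is the maximum of $\deg_H(v)$ over all vertices. An independent set is a set $I\subseteq V$ containing no edge of $H$ as a subset; it is balanced if $|I\cap V_i| = |I\cap V_j|$ for all $i,j\in[k]$. A balanced $q$-coloring of $H$ is a map $\varphi: V\to[q]$ such that every color class $\varphi^{-1}(i)$, $i\in[q]$, is a balanced independent set. The balanced chromatic number $\chi_b(H)$ is the minimum number $q$ of colors for which a balanced $q$-coloring exists. $\log$ is the natural logarithm. *)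

theory Defs
  imports Complex_Main "HOL-Library.Extended_Real" "HOL-Library.Disjoint_Sets"
begin

definition hypergraph :: "'a set \<Rightarrow> 'a set set \<Rightarrow> bool" where
  "hypergraph V E \<longleftrightarrow> finite V \<and> (\<forall>e\<in>E. e \<subseteq> V)"

definition uniform_hypergraph :: "nat \<Rightarrow> 'a set \<Rightarrow> 'a set set \<Rightarrow> bool" where
  "uniform_hypergraph k V E \<longleftrightarrow> hypergraph V E \<and> (\<forall>e\<in>E. card e = k)"

(* The partition is part of the data: P i is the i-th vertex class, and only the values P 1, ..., P k matter. *)
definition partite_hypergraph ::
    "nat \<Rightarrow> (nat \<Rightarrow> 'a set) \<Rightarrow> 'a set \<Rightarrow> 'a set set \<Rightarrow> bool" where
  "partite_hypergraph k P V E \<longleftrightarrow>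
     uniform_hypergraph k V E \<and>
     V = (\<Union>i\<in>{1..k}. P i) \<and> disjoint_family_on P {1..k} \<and>
     (\<forall>e\<in>E. \<forall>i\<in>{1..k}. card (e \<inter> P i) = 1)"

definition balanced_partite_hypergraph ::
    "nat \<Rightarrow> nat \<Rightarrow> (nat \<Rightarrow> 'a set) \<Rightarrow> 'a set \<Rightarrow> 'a set set \<Rightarrow> bool" where
  "balanced_partite_hypergraph n k P V E \<longleftrightarrow>
     partite_hypergraph k P V E \<and> (\<forall>i\<in>{1..k}. card (P i) = n)"

definition vertex_degree :: "'a set set \<Rightarrow> 'a \<Rightarrow> nat" where
  "vertex_degree E v = card {e \<in> E. v \<in> e}"

definition max_degree :: "'a set \<Rightarrow> 'a set set \<Rightarrow> nat" where
  "max_degree V E = Max (vertex_degree E ` V)"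

definition independent_set :: "'a set \<Rightarrow> 'a set set \<Rightarrow> 'a set \<Rightarrow> bool" where
  "independent_set V E I \<longleftrightarrow> I \<subseteq> V \<and> (\<forall>e\<in>E. \<not> e \<subseteq> I)"

definition balanced_independent_set ::
    "nat \<Rightarrow> (nat \<Rightarrow> 'a set) \<Rightarrow> 'a set \<Rightarrow> 'a set set \<Rightarrow> 'a set \<Rightarrow> bool" where
  "balanced_independent_set k P V E I \<longleftrightarrow>
     independent_set V E I \<and> (\<forall>i\<in>{1..k}. \<forall>j\<in>{1..k}. card (I \<inter> P i) = card (I \<inter> P j))"

definition balanced_coloring ::
    "nat \<Rightarrow> (nat \<Rightarrow> 'a set) \<Rightarrow> 'a set \<Rightarrow> 'a set set \<Rightarrow> nat \<Rightarrow> ('a \<Rightarrow> nat) \<Rightarrow> bool" where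
  "balanced_coloring k P V E q \<phi> \<longleftrightarrow>
     (\<forall>v\<in>V. \<phi> v \<in> {1..q}) \<and>
     (\<forall>c\<in>{1..q}. balanced_independent_set k P V E {v \<in> V. \<phi> v = c})"

(* Some hypergraphs have no balanced coloring at all (e.g. a single edge on its own k vertices).
   Taking the infimum in enat gives those the value infinity, so that a finite upper bound on the
   balanced chromatic number includes the existence of a balanced coloring; for a nonempty
   set of admissible q the infimum is the minimum. *)
definition balanced_chromatic_number ::
    "nat \<Rightarrow> (nat \<Rightarrow> 'a set) \<Rightarrow> 'a set \<Rightarrow> 'a set set \<Rightarrow> enat" where
  "balanced_chromatic_number k P V E =
     Inf {enat q | q. \<exists>\<phi>. balanced_coloring k P V E q \<phi>}"

end

theory Submission
  imports Defs "HOL-Library.FuncSet" "HOL-Analysis.Convex" "HOL-Real_Asymp.Real_Asymp"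
begin

text \<open>
  Color the vertices of the first \<open>k - 1\<close> parts independently and uniformly with \<open>q\<close> colors, and then
  let every vertex of the last part take a color that makes none of its edges monochromatic. If
  \<open>q\<close> is about \<open>((k - 1 + \<epsilon>) \<Delta> / ln \<Delta>) powr (1 / (k - 1))\<close>, a given color is allowed at a given vertex with
  probability at least about \<open>\<Delta> powr (- 1 / (k - 1 + \<epsilon>))\<close> by Harris' inequality
  (\<open>mean_avoid_all_ge\<close>). Since \<open>q\<close> grows like \<open>\<Delta> powr (1 / (k - 1))\<close> up to a logarithm, one expects a
  positive power of \<open>\<Delta>\<close> many allowed colors. The events that different colors are forbidden are
  negatively correlated (\<open>negative_association\<close>), so the probability that no color is allowed is smaller
  than any power of \<open>1 / \<Delta>\<close> (\<open>mean_every_class_hit_le\<close>).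

  Balance comes from symmetry and concentration. If several colors are allowed, the choice must treat
  the colors alike. Each vertex of the last part therefore also receives a uniform random color, and
  takes the first allowed color that follows it cyclically. This rule commutes with rotations of the
  color cycle, so the color of every vertex is exactly uniform (\<open>color_uniform\<close>). It depends on the
  closed neighborhood of the vertex alone, and such a neighborhood meets only \<open>O(\<Delta>\<^sup>2)\<close> others; the second
  moment method shows that the sizes of the color classes in all parts are close to \<open>n / q\<close>
  (\<open>good_random_coloring\<close>).

  It remains to repair a coloring that is almost perfect. Uncolor the vertices without an allowed
  color and trim every color class to equal sizes in the \<open>k\<close> parts; this leaves a small number \<open>u\<close> of
  uncolored vertices in each part. Now \<open>k\<close> additional colors suffice
  (\<open>balanced_coloring_of_partial_coloring\<close>): the \<open>j\<close>-th of them is given to the uncolored vertices of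
  part \<open>j\<close> and, in every other part, to \<open>u\<close> vertices that are taken away from the old classes and have no
  uncolored neighbor. An edge in this new class would join an uncolored vertex of part \<open>j\<close> to one of its
  non-neighbors. The vertices are taken from all old classes together, not from a single one, so that it
  suffices that \<open>u\<close> is at most a constant times \<open>n / \<Delta>\<close>; this is what the lower bound on \<open>n\<close> provides.
  The \<open>k\<close> additional colors are absorbed by \<open>\<epsilon>\<close>, because the number of colors tends to infinity.
\<close>

section \<open>Averages over all colorings of a finite set\<close>

text \<open>
  The expectation of \<open>f\<close> when every element of \<open>W\<close> receives an independent uniform element of \<open>Q\<close>.
\<close>
definition mean :: "'c set \<Rightarrow> 'a set \<Rightarrow> (('a \<Rightarrow> 'c) \<Rightarrow> real) \<Rightarrow> real" where
  "mean Q W f = (\<Sum>\<sigma>\<in>W \<rightarrow>\<^sub>E Q. f \<sigma>) / real (card Q) ^ card W"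

lemma mean_add: "mean Q W (\<lambda>\<sigma>. f \<sigma> + g \<sigma>) = mean Q W f + mean Q W g"
  by (simp add: mean_def sum.distrib add_divide_distrib)

lemma mean_diff: "mean Q W (\<lambda>\<sigma>. f \<sigma> - g \<sigma>) = mean Q W f - mean Q W g"
  by (simp add: mean_def sum_subtractf diff_divide_distrib)

lemma mean_cmult: "mean Q W (\<lambda>\<sigma>. c * f \<sigma>) = c * mean Q W f"
  by (simp add: mean_def sum_distrib_left)

lemma mean_sum: "mean Q W (\<lambda>\<sigma>. \<Sum>i\<in>A. f i \<sigma>) = (\<Sum>i\<in>A. mean Q W (f i))"
  unfolding mean_def by (subst sum.swap) (simp add: sum_divide_distrib)

lemma mean_cong:
  "(\<And>\<sigma>. \<sigma> \<in> W \<rightarrow>\<^sub>E Q \<Longrightarrow> f \<sigma> = g \<sigma>) \<Longrightarrow> mean Q W f = mean Q W g"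
  by (simp add: mean_def)

lemma mean_mono:
  "(\<And>\<sigma>. \<sigma> \<in> W \<rightarrow>\<^sub>E Q \<Longrightarrow> f \<sigma> \<le> g \<sigma>) \<Longrightarrow> mean Q W f \<le> mean Q W g"
  by (auto simp: mean_def intro!: divide_right_mono sum_mono)

lemma mean_const:
  assumes "finite W" "finite Q" "Q \<noteq> {}"
  shows "mean Q W (\<lambda>_. c) = c"
  using assms by (simp add: mean_def card_PiE)

text \<open>
  Revealing the color of one point: all inequalities below are proved by induction on \<open>W\<close> with this
  recursion.
\<close>
lemma mean_insert:
  assumes "finite W" "w \<notin> W"
  shows "mean Q (insert w W) f = (\<Sum>a\<in>Q. mean Q W (\<lambda>\<sigma>. f (\<sigma>(w := a)))) / real (card Q)"
proof -
  have "(\<Sum>\<sigma>\<in>insert w W \<rightarrow>\<^sub>E Q. f \<sigma>) = (\<Sum>a\<in>Q. \<Sum>\<sigma>\<in>W \<rightarrow>\<^sub>E Q. f (\<sigma>(w := a)))"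
    unfolding PiE_insert_eq
    by (subst sum.reindex[OF inj_combinator[OF assms(2)]])
       (simp add: sum.cartesian_product case_prod_unfold)
  then show ?thesis
    using assms by (simp add: mean_def sum_divide_distrib[symmetric])
qed

lemma mean_attained:
  assumes "finite W" "finite Q" "Q \<noteq> {}"
  shows "\<exists>\<sigma>\<in>W \<rightarrow>\<^sub>E Q. f \<sigma> \<le> mean Q W f"
proof (rule ccontr)
  assume "\<not> ?thesis"
  then have *: "\<And>\<sigma>. \<sigma> \<in> W \<rightarrow>\<^sub>E Q \<Longrightarrow> mean Q W f < f \<sigma>" by force
  have ne: "W \<rightarrow>\<^sub>E Q \<noteq> {}" using assms by (simp add: PiE_eq_empty_iff)
  have N: "real (card Q) ^ card W > 0" using assms by (simp add: card_gt_0_iff)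
  have "(\<Sum>\<sigma>\<in>W \<rightarrow>\<^sub>E Q. mean Q W f) < (\<Sum>\<sigma>\<in>W \<rightarrow>\<^sub>E Q. f \<sigma>)"
    by (intro sum_strict_mono finite_PiE ne assms *)
  moreover have "(\<Sum>\<sigma>\<in>W \<rightarrow>\<^sub>E Q. f \<sigma>) = real (card Q) ^ card W * mean Q W f"
    using N by (simp add: mean_def)
  ultimately show False using assms by (simp add: card_PiE)
qed

text \<open>
  At each step of the induction, the revealed point is irrelevant for \<open>f\<close> or for \<open>g\<close>, so that one of the two
  means is a constant factor.
\<close>
lemma mean_independent:
  fixes f g :: "('a \<Rightarrow> 'c) \<Rightarrow> real"
  assumes "finite W" "finite Q" "Q \<noteq> {}" "S \<inter> T = {}"
    and "\<And>\<sigma> \<sigma>'. (\<And>x. x \<in> S \<Longrightarrow> \<sigma> x = \<sigma>' x) \<Longrightarrow> f \<sigma> = f \<sigma>'"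
    and "\<And>\<sigma> \<sigma>'. (\<And>x. x \<in> T \<Longrightarrow> \<sigma> x = \<sigma>' x) \<Longrightarrow> g \<sigma> = g \<sigma>'"
  shows "mean Q W (\<lambda>\<sigma>. f \<sigma> * g \<sigma>) = mean Q W f * mean Q W g"
  using assms(1,5,6)
proof (induction W arbitrary: f g rule: finite_induct)
  case empty
  show ?case by (simp add: mean_def)
next
  case (insert w W)
  have card: "real (card Q) \<noteq> 0" using assms by simp
  note ins = mean_insert[OF insert.hyps]
  have IH: "mean Q W (\<lambda>\<sigma>. f (\<sigma>(w := a)) * g (\<sigma>(w := a))) =
        mean Q W (\<lambda>\<sigma>. f (\<sigma>(w := a))) * mean Q W (\<lambda>\<sigma>. g (\<sigma>(w := a)))" for a
    by (rule insert.IH; rule insert.prems) auto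
  show ?case
  proof (cases "w \<in> S")
    case True
    then have "w \<notin> T" using assms(4) by auto
    then have g: "g (\<sigma>(w := a)) = g \<sigma>" for \<sigma> a
      by (intro insert.prems(2)) auto
    have "mean Q (insert w W) (\<lambda>\<sigma>. f \<sigma> * g \<sigma>)
        = (\<Sum>a\<in>Q. mean Q W (\<lambda>\<sigma>. f (\<sigma>(w := a))) * mean Q W g) / card Q"
      using IH by (simp add: ins g)
    also have "\<dots> = mean Q (insert w W) f * mean Q (insert w W) g"
      using card by (simp add: ins g sum_distrib_right)
    finally show ?thesis .
  next
    case False
    then have f: "f (\<sigma>(w := a)) = f \<sigma>" for \<sigma> a
      by (intro insert.prems(1)) auto
    have "mean Q (insert w W) (\<lambda>\<sigma>. f \<sigma> * g \<sigma>)
        = (\<Sum>a\<in>Q. mean Q W f * mean Q W (\<lambda>\<sigma>. g (\<sigma>(w := a)))) / card Q"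
      using IH by (simp add: ins f)
    also have "\<dots> = mean Q (insert w W) f * mean Q (insert w W) g"
      using card by (simp add: ins f sum_distrib_left)
    finally show ?thesis .
  qed
qed

section \<open>Correlation inequalities for color classes\<close>

lemma color_class_upd:
  assumes "w \<notin> W"
  shows "{x \<in> insert w W. (\<sigma>(w := a)) x = c} =
    (if a = c then insert w {x \<in> W. \<sigma> x = c} else {x \<in> W. \<sigma> x = c})"
  using assms by auto

lemma sum_if_eq_split:
  fixes x y :: real
  assumes "finite Q" "c \<in> Q"
  shows "(\<Sum>a\<in>Q. if a = c then x else y) = x + (real (card Q) - 1) * y"
proof -
  have "(\<Sum>a\<in>Q. if a = c then x else y) = x + (\<Sum>a\<in>Q - {c}. if a = c then x else y)"
    using assms by (simp add: sum.remove)
  also have "(\<Sum>a\<in>Q - {c}. if a = c then x else y) = (\<Sum>a\<in>Q - {c}. y)"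
    by (intro sum.cong) auto
  also have "\<dots> = (real (card Q) - 1) * y"
  proof -
    have "card Q \<ge> 1" using assms by (auto simp: card_gt_0_iff Suc_le_eq)
    then show ?thesis using assms by (simp add: of_nat_diff)
  qed
  finally show ?thesis .
qed

text \<open>
  Harris' inequality for a single color class, which is a random set containing each point independently
  with probability \<open>1 / card Q\<close>. Adding a point to the class lowers both functions, so
  conditioning on whether the new point belongs to it correlates them positively; this is the product
  \<open>(a0 - a1) * (b0 - b1)\<close> in the proof.
\<close>
lemma harris:
  fixes f g :: "'a set \<Rightarrow> real"
  assumes "finite W" "finite Q" "c \<in> Q"
    and "\<And>X Y. X \<subseteq> Y \<Longrightarrow> f Y \<le> f X" "\<And>X Y. X \<subseteq> Y \<Longrightarrow> g Y \<le> g X"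
  shows "mean Q W (\<lambda>\<sigma>. f {x \<in> W. \<sigma> x = c}) * mean Q W (\<lambda>\<sigma>. g {x \<in> W. \<sigma> x = c})
    \<le> mean Q W (\<lambda>\<sigma>. f {x \<in> W. \<sigma> x = c} * g {x \<in> W. \<sigma> x = c})"
  using assms(1,4,5)
proof (induction W arbitrary: f g rule: finite_induct)
  case empty
  show ?case by (simp add: mean_def)
next
  case (insert w W)
  let ?X = "\<lambda>\<sigma>. {x \<in> W. \<sigma> x = c}"
  define N where "N = real (card Q)"
  have N1: "N \<ge> 1" using assms by (auto simp: N_def Suc_le_eq card_gt_0_iff)
  have ins: "mean Q (insert w W) (\<lambda>\<sigma>. h {x \<in> insert w W. \<sigma> x = c})
      = (mean Q W (\<lambda>\<sigma>. h (insert w (?X \<sigma>))) + (N - 1) * mean Q W (\<lambda>\<sigma>. h (?X \<sigma>))) / N"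
    for h :: "'a set \<Rightarrow> real"
  proof -
    have "mean Q (insert w W) (\<lambda>\<sigma>. h {x \<in> insert w W. \<sigma> x = c})
        = (\<Sum>a\<in>Q. if a = c then mean Q W (\<lambda>\<sigma>. h (insert w (?X \<sigma>)))
              else mean Q W (\<lambda>\<sigma>. h (?X \<sigma>))) / N"
      unfolding mean_insert[OF insert.hyps] color_class_upd[OF insert.hyps(2)] N_def
      by (intro arg_cong2[of _ _ _ _ "(/)"] sum.cong) auto
    then show ?thesis using sum_if_eq_split[OF assms(2,3)] by (simp add: N_def)
  qed
  define a1 a0 b1 b0 where
    "a1 = mean Q W (\<lambda>\<sigma>. f (insert w (?X \<sigma>)))" and "a0 = mean Q W (\<lambda>\<sigma>. f (?X \<sigma>))" and
    "b1 = mean Q W (\<lambda>\<sigma>. g (insert w (?X \<sigma>)))" and "b0 = mean Q W (\<lambda>\<sigma>. g (?X \<sigma>))"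
  have a: "a1 \<le> a0" unfolding a1_def a0_def by (intro mean_mono insert.prems) auto
  have b: "b1 \<le> b0" unfolding b1_def b0_def by (intro mean_mono insert.prems) auto
  have fg1: "a1 * b1 \<le> mean Q W (\<lambda>\<sigma>. f (insert w (?X \<sigma>)) * g (insert w (?X \<sigma>)))"
    unfolding a1_def b1_def
    by (rule insert.IH[of "\<lambda>X. f (insert w X)" "\<lambda>X. g (insert w X)"])
       (auto intro!: insert.prems)
  have fg0: "a0 * b0 \<le> mean Q W (\<lambda>\<sigma>. f (?X \<sigma>) * g (?X \<sigma>))"
    unfolding a0_def b0_def by (rule insert.IH) (auto intro!: insert.prems)
  have "0 \<le> (N - 1) * ((a0 - a1) * (b0 - b1))"
    using N1 a b by (intro mult_nonneg_nonneg) auto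
  then have "(a1 + (N - 1) * a0) / N * ((b1 + (N - 1) * b0) / N)
      \<le> (a1 * b1 + (N - 1) * (a0 * b0)) / N"
    using N1 by (simp add: divide_simps) (simp add: algebra_simps)
  also have "\<dots> \<le> mean Q (insert w W)
      (\<lambda>\<sigma>. f {x \<in> insert w W. \<sigma> x = c} * g {x \<in> insert w W. \<sigma> x = c})"
    unfolding ins[of "\<lambda>X. f X * g X"]
    using N1 fg1 fg0 by (intro divide_right_mono add_mono mult_left_mono) auto
  finally show ?case
    unfolding ins[of f] ins[of g] a1_def a0_def b1_def b0_def .
qed

lemma mean_subset_class:
  assumes "finite W" "finite Q" "c \<in> Q" "l \<subseteq> W"
  shows "mean Q W (\<lambda>\<sigma>. of_bool (l \<subseteq> {x \<in> W. \<sigma> x = c})) = 1 / real (card Q) ^ card l"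
proof -
  have fl: "finite l" using assms finite_subset by blast
  have N: "real (card Q) > 0" using assms by (auto simp: card_gt_0_iff)
  have "(W \<rightarrow>\<^sub>E Q) \<inter> {\<sigma>. l \<subseteq> {x \<in> W. \<sigma> x = c}} = PiE W (\<lambda>w. if w \<in> l then {c} else Q)"
    using assms(3,4) by (auto simp: PiE_iff extensional_def split: if_splits)
  moreover have "card (PiE W (\<lambda>w. if w \<in> l then {c} else Q)) = card Q ^ card (W - l)"
  proof -
    have "card (PiE W (\<lambda>w. if w \<in> l then {c} else Q)) = (\<Prod>w\<in>W. if w \<in> l then 1 else card Q)"
      using assms by (subst card_PiE) (auto intro!: prod.cong)
    also have "\<dots> = (\<Prod>w\<in>W - l. card Q)"
      using assms by (intro prod.mono_neutral_cong_right) auto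
    finally show ?thesis by simp
  qed
  ultimately have "(\<Sum>\<sigma>\<in>W \<rightarrow>\<^sub>E Q. of_bool (l \<subseteq> {x \<in> W. \<sigma> x = c})) = real (card Q ^ card (W - l))"
    using assms by (simp add: finite_PiE)
  moreover have "card W = card (W - l) + card l"
    using assms fl by (simp add: card_Diff_subset card_mono)
  ultimately show ?thesis using N by (simp add: mean_def power_add)
qed

text \<open>
  Avoiding a set is a decreasing event, so by Harris' inequality the sets in \<open>L\<close> can only help each other
  to be avoided, however they overlap.
\<close>
lemma mean_avoid_all_ge:
  assumes "finite W" "finite Q" "c \<in> Q" "finite L" "\<And>l. l \<in> L \<Longrightarrow> l \<subseteq> W"
  shows "(\<Prod>l\<in>L. 1 - 1 / real (card Q) ^ card l)
    \<le> mean Q W (\<lambda>\<sigma>. of_bool (\<forall>l\<in>L. \<not> l \<subseteq> {x \<in> W. \<sigma> x = c}))"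
  using assms(4,5)
proof (induction L rule: finite_induct)
  case empty
  have "Q \<noteq> {}" using assms by auto
  then show ?case using assms mean_const[of W Q 1] by simp
next
  case (insert l L)
  have N: "real (card Q) \<ge> 1" using assms by (auto simp: Suc_le_eq card_gt_0_iff)
  have single: "mean Q W (\<lambda>\<sigma>. of_bool (\<not> l \<subseteq> {x \<in> W. \<sigma> x = c})) = 1 - 1 / real (card Q) ^ card l"
  proof -
    have "mean Q W (\<lambda>\<sigma>. of_bool (\<not> l \<subseteq> {x \<in> W. \<sigma> x = c}))
        = mean Q W (\<lambda>\<sigma>. 1 - of_bool (l \<subseteq> {x \<in> W. \<sigma> x = c}))"
      by (intro mean_cong) simp
    then show ?thesis
      using assms insert.prems mean_subset_class[of W Q c l] mean_const[of W Q 1]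
      by (auto simp: mean_diff)
  qed
  have "(\<Prod>l\<in>insert l L. 1 - 1 / real (card Q) ^ card l)
      = (1 - 1 / real (card Q) ^ card l) * (\<Prod>l\<in>L. 1 - 1 / real (card Q) ^ card l)"
    using insert.hyps by simp
  also have "\<dots> \<le> (1 - 1 / real (card Q) ^ card l) *
      mean Q W (\<lambda>\<sigma>. of_bool (\<forall>l\<in>L. \<not> l \<subseteq> {x \<in> W. \<sigma> x = c}))"
    using N insert.prems by (intro mult_left_mono insert.IH) (auto simp: divide_simps)
  also have "\<dots> \<le> mean Q W (\<lambda>\<sigma>. of_bool (\<not> l \<subseteq> {x \<in> W. \<sigma> x = c}) *
      of_bool (\<forall>l\<in>L. \<not> l \<subseteq> {x \<in> W. \<sigma> x = c}))"
    unfolding single[symmetric]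
    by (rule harris[OF assms(1-3), of "\<lambda>X. of_bool (\<not> l \<subseteq> X)" "\<lambda>X. of_bool (\<forall>l\<in>L. \<not> l \<subseteq> X)"])
       (auto simp: of_bool_def)
  also have "\<dots> = mean Q W (\<lambda>\<sigma>. of_bool (\<forall>l\<in>insert l L. \<not> l \<subseteq> {x \<in> W. \<sigma> x = c}))"
    by (intro mean_cong) auto
  finally show ?case .
qed

text \<open>
  The terms of degree at most one in \<open>d\<close> in the expansion of the right-hand side.
\<close>
lemma prod_add_ge:
  fixes x d :: "'c \<Rightarrow> real"
  assumes "finite Q" "\<And>c. c \<in> Q \<Longrightarrow> x c \<ge> 0" "\<And>c. c \<in> Q \<Longrightarrow> d c \<ge> 0"
  shows "(\<Prod>c\<in>Q. x c) + (\<Sum>a\<in>Q. d a * (\<Prod>c\<in>Q - {a}. x c)) \<le> (\<Prod>c\<in>Q. x c + d c)"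
  using assms
proof (induction Q rule: finite_induct)
  case empty
  then show ?case by simp
next
  case (insert b Q)
  let ?S = "\<Sum>a\<in>Q. d a * (\<Prod>c\<in>Q - {a}. x c)"
  have "(\<Sum>a\<in>Q. d a * (\<Prod>c\<in>insert b Q - {a}. x c)) = (\<Sum>a\<in>Q. x b * (d a * (\<Prod>c\<in>Q - {a}. x c)))"
  proof (intro sum.cong refl)
    fix a assume "a \<in> Q"
    then have "insert b Q - {a} = insert b (Q - {a})" using insert.hyps by auto
    then show "d a * (\<Prod>c\<in>insert b Q - {a}. x c) = x b * (d a * (\<Prod>c\<in>Q - {a}. x c))"
      using insert.hyps by simp
  qed
  then have "(\<Prod>c\<in>insert b Q. x c) + (\<Sum>a\<in>insert b Q. d a * (\<Prod>c\<in>insert b Q - {a}. x c))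
      = x b * ((\<Prod>c\<in>Q. x c) + ?S) + d b * (\<Prod>c\<in>Q. x c)"
    using insert.hyps by (simp add: sum_distrib_left algebra_simps)
  also have "\<dots> \<le> x b * (\<Prod>c\<in>Q. x c + d c) + d b * (\<Prod>c\<in>Q. x c + d c)"
    using insert.IH insert.prems
    by (intro add_mono mult_left_mono prod_mono) (auto intro: add_increasing2)
  also have "\<dots> = (\<Prod>c\<in>insert b Q. x c + d c)"
    using insert.hyps by (simp add: algebra_simps)
  finally show ?case .
qed

text \<open>
  Different color classes compete for the points. Conditioning on the color \<open>a\<close> of one new point replaces the
  factor \<open>x a\<close> of a single color by the larger \<open>y a\<close>, whereas on the right-hand side every factor
  gains its share \<open>(y a - x a) / N\<close>; expanding that product gives the average of the conditioned terms and
  further nonnegative ones.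
\<close>
lemma negative_association:
  fixes F :: "'c \<Rightarrow> 'a set \<Rightarrow> real"
  assumes "finite W" "finite Q" "Q \<noteq> {}"
    and "\<And>c X. F c X \<ge> 0" "\<And>c X Y. X \<subseteq> Y \<Longrightarrow> F c X \<le> F c Y"
  shows "mean Q W (\<lambda>\<sigma>. \<Prod>c\<in>Q. F c {x \<in> W. \<sigma> x = c})
    \<le> (\<Prod>c\<in>Q. mean Q W (\<lambda>\<sigma>. F c {x \<in> W. \<sigma> x = c}))"
  using assms(1,4,5)
proof (induction W arbitrary: F rule: finite_induct)
  case empty
  show ?case by (simp add: mean_def)
next
  case (insert w W)
  let ?X = "\<lambda>c \<sigma>. {x \<in> W. \<sigma> x = c}"
  define N where "N = real (card Q)"
  have N: "N > 0" using assms by (simp add: N_def card_gt_0_iff)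
  define x where "x c = mean Q W (\<lambda>\<sigma>. F c (?X c \<sigma>))" for c
  define y where "y c = mean Q W (\<lambda>\<sigma>. F c (insert w (?X c \<sigma>)))" for c
  have xy: "x c \<le> y c" for c unfolding x_def y_def by (intro mean_mono insert.prems) auto
  have x0: "x c \<ge> 0" for c
    unfolding x_def mean_def by (intro divide_nonneg_nonneg sum_nonneg insert.prems) auto
  have marg: "mean Q (insert w W) (\<lambda>\<sigma>. F c {x \<in> insert w W. \<sigma> x = c}) = x c + (y c - x c) / N"
    if "c \<in> Q" for c
  proof -
    have "mean Q (insert w W) (\<lambda>\<sigma>. F c {x \<in> insert w W. \<sigma> x = c})
        = (\<Sum>a\<in>Q. if a = c then y c else x c) / N"
      unfolding mean_insert[OF insert.hyps] color_class_upd[OF insert.hyps(2)] N_def x_def y_def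
      by (intro arg_cong2[of _ _ _ _ "(/)"] sum.cong) auto
    then show ?thesis
      using sum_if_eq_split[OF assms(2) that] N by (simp add: N_def field_simps)
  qed
  have step: "mean Q W (\<lambda>\<sigma>. \<Prod>c\<in>Q. F c {x \<in> insert w W. (\<sigma>(w := a)) x = c})
      \<le> y a * (\<Prod>c\<in>Q - {a}. x c)" if a: "a \<in> Q" for a
  proof -
    define G where "G c = (if a = c then (\<lambda>X. F c (insert w X)) else F c)" for c
    have "mean Q W (\<lambda>\<sigma>. \<Prod>c\<in>Q. F c {x \<in> insert w W. (\<sigma>(w := a)) x = c})
        = mean Q W (\<lambda>\<sigma>. \<Prod>c\<in>Q. G c (?X c \<sigma>))"
      unfolding color_class_upd[OF insert.hyps(2)] G_def
      by (intro mean_cong prod.cong) auto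
    also have "\<dots> \<le> (\<Prod>c\<in>Q. mean Q W (\<lambda>\<sigma>. G c (?X c \<sigma>)))"
      by (rule insert.IH) (auto simp: G_def intro!: insert.prems)
    also have "\<dots> = (\<Prod>c\<in>Q. if a = c then y c else x c)"
      by (intro prod.cong) (auto simp: G_def x_def y_def)
    also have "\<dots> = y a * (\<Prod>c\<in>Q - {a}. if a = c then y c else x c)"
      using assms(2) a by (simp add: prod.remove)
    also have "(\<Prod>c\<in>Q - {a}. if a = c then y c else x c) = (\<Prod>c\<in>Q - {a}. x c)"
      by (intro prod.cong) auto
    finally show ?thesis .
  qed
  have "mean Q (insert w W) (\<lambda>\<sigma>. \<Prod>c\<in>Q. F c {x \<in> insert w W. \<sigma> x = c})
      \<le> (\<Sum>a\<in>Q. y a * (\<Prod>c\<in>Q - {a}. x c)) / N"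
    unfolding mean_insert[OF insert.hyps] N_def
    by (intro divide_right_mono sum_mono step) auto
  also have "(\<Sum>a\<in>Q. y a * (\<Prod>c\<in>Q - {a}. x c))
      = (\<Sum>a\<in>Q. (\<Prod>c\<in>Q. x c) + (y a - x a) * (\<Prod>c\<in>Q - {a}. x c))"
    using assms(2) by (intro sum.cong refl) (simp add: prod.remove algebra_simps)
  also have "\<dots> / N = (\<Prod>c\<in>Q. x c) + (\<Sum>a\<in>Q. (y a - x a) / N * (\<Prod>c\<in>Q - {a}. x c))"
    using N by (simp add: sum.distrib add_divide_distrib N_def sum_divide_distrib)
  also have "\<dots> \<le> (\<Prod>c\<in>Q. x c + (y c - x c) / N)"
    using N xy x0 by (intro prod_add_ge assms(2)) auto
  also have "\<dots> = (\<Prod>c\<in>Q. mean Q (insert w W) (\<lambda>\<sigma>. F c {x \<in> insert w W. \<sigma> x = c}))"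
    by (intro prod.cong refl marg[symmetric])
  finally show ?case .
qed

text \<open>
  Containing a member of \<open>L\<close> is an increasing property of a color class, so the events for the different
  colors are negatively correlated; each of them is bounded by Harris' inequality.
\<close>
lemma mean_every_class_hit_le:
  assumes "finite W" "finite Q" "Q \<noteq> {}" "finite L" "\<And>l. l \<in> L \<Longrightarrow> l \<subseteq> W"
    and "\<And>l. l \<in> L \<Longrightarrow> card l = m" "card L \<le> D"
  shows "mean Q W (\<lambda>\<sigma>. of_bool (\<forall>c\<in>Q. \<exists>l\<in>L. l \<subseteq> {x \<in> W. \<sigma> x = c}))
    \<le> (1 - (1 - 1 / real (card Q) ^ m) ^ D) ^ card Q"
proof -
  define N where "N = real (card Q)"
  have N: "N \<ge> 1" using assms by (auto simp: N_def Suc_le_eq card_gt_0_iff)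
  have single: "mean Q W (\<lambda>\<sigma>. of_bool (\<exists>l\<in>L. l \<subseteq> {x \<in> W. \<sigma> x = c})) \<le> 1 - (1 - 1 / N ^ m) ^ D"
    if c: "c \<in> Q" for c
  proof -
    have "(1 - 1 / N ^ m) ^ D \<le> (1 - 1 / N ^ m) ^ card L"
      using N assms by (intro power_decreasing) auto
    also have "\<dots> = (\<Prod>l\<in>L. 1 - 1 / N ^ card l)"
      using assms by simp
    also have "\<dots> \<le> mean Q W (\<lambda>\<sigma>. of_bool (\<forall>l\<in>L. \<not> l \<subseteq> {x \<in> W. \<sigma> x = c}))"
      unfolding N_def by (rule mean_avoid_all_ge) (use assms c in auto)
    also have "\<dots> = mean Q W (\<lambda>\<sigma>. 1 - of_bool (\<exists>l\<in>L. l \<subseteq> {x \<in> W. \<sigma> x = c}))"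
      by (intro mean_cong) auto
    also have "\<dots> = 1 - mean Q W (\<lambda>\<sigma>. of_bool (\<exists>l\<in>L. l \<subseteq> {x \<in> W. \<sigma> x = c}))"
      using assms by (simp add: mean_diff mean_const)
    finally show ?thesis by simp
  qed
  have "mean Q W (\<lambda>\<sigma>. of_bool (\<forall>c\<in>Q. \<exists>l\<in>L. l \<subseteq> {x \<in> W. \<sigma> x = c}))
      = mean Q W (\<lambda>\<sigma>. \<Prod>c\<in>Q. of_bool (\<exists>l\<in>L. l \<subseteq> {x \<in> W. \<sigma> x = c}))"
    using assms(2) by (intro mean_cong) (auto simp: of_bool_def prod_zero_iff)
  also have "\<dots> \<le> (\<Prod>c\<in>Q. mean Q W (\<lambda>\<sigma>. of_bool (\<exists>l\<in>L. l \<subseteq> {x \<in> W. \<sigma> x = c})))"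
    by (rule negative_association[OF assms(1-3), of "\<lambda>_ X. of_bool (\<exists>l\<in>L. l \<subseteq> X)"])
       (auto simp: of_bool_def)
  also have "\<dots> \<le> (\<Prod>c\<in>Q. 1 - (1 - 1 / N ^ m) ^ D)"
    by (intro prod_mono conjI single) (auto simp: mean_def intro!: divide_nonneg_nonneg sum_nonneg)
  finally show ?thesis by (simp add: N_def)
qed

section \<open>Second moment for locally determined events\<close>

text \<open>
  Only pairs with intersecting supports contribute to the variance, and each contributes at most \<open>p\<close>.
\<close>
lemma second_moment_le:
  fixes Z :: "'a \<Rightarrow> ('a \<Rightarrow> 'c) \<Rightarrow> bool"
  assumes fin: "finite W" "finite Q" "Q \<noteq> {}" "finite A"
    and local: "\<And>v \<sigma> \<sigma>'. v \<in> A \<Longrightarrow> (\<And>x. x \<in> S v \<Longrightarrow> \<sigma> x = \<sigma>' x) \<Longrightarrow> Z v \<sigma> = Z v \<sigma>'"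
    and p: "\<And>v. v \<in> A \<Longrightarrow> mean Q W (\<lambda>\<sigma>. of_bool (Z v \<sigma>)) = p"
    and d: "\<And>v. v \<in> A \<Longrightarrow> card {v' \<in> A. S v \<inter> S v' \<noteq> {}} \<le> d"
  shows "mean Q W (\<lambda>\<sigma>. (real (card {v \<in> A. Z v \<sigma>}) - real (card A) * p)\<^sup>2) \<le> real (card A) * real d * p"
proof (cases "A = {}")
  case True
  then show ?thesis by (simp add: mean_const fin)
next
  case False
  let ?Y = "\<lambda>v \<sigma>. of_bool (Z v \<sigma>) :: real"
  have p0: "p \<ge> 0"
  proof -
    obtain v where "v \<in> A" using False by auto
    then have "p = mean Q W (?Y v)" using p by simp
    then show ?thesis by (simp add: mean_def divide_nonneg_nonneg sum_nonneg)
  qed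
  have cov: "mean Q W (\<lambda>\<sigma>. (?Y v \<sigma> - p) * (?Y v' \<sigma> - p)) \<le> of_bool (S v \<inter> S v' \<noteq> {}) * p"
    if "v \<in> A" "v' \<in> A" for v v'
  proof -
    have "mean Q W (\<lambda>\<sigma>. (?Y v \<sigma> - p) * (?Y v' \<sigma> - p))
        = mean Q W (\<lambda>\<sigma>. ?Y v \<sigma> * ?Y v' \<sigma> - p * ?Y v \<sigma> - p * ?Y v' \<sigma> + p * p)"
      by (intro mean_cong) (simp add: algebra_simps)
    also have "\<dots> = mean Q W (\<lambda>\<sigma>. ?Y v \<sigma> * ?Y v' \<sigma>) - p * p"
      unfolding mean_add mean_diff mean_cmult mean_const[OF fin(1-3)] p[OF that(1)] p[OF that(2)]
      by simp
    also have "\<dots> \<le> of_bool (S v \<inter> S v' \<noteq> {}) * p"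
    proof (cases "S v \<inter> S v' = {}")
      case True
      have "mean Q W (\<lambda>\<sigma>. ?Y v \<sigma> * ?Y v' \<sigma>) = mean Q W (?Y v) * mean Q W (?Y v')"
        by (rule mean_independent[OF fin(1-3) True]; rule arg_cong[where f = of_bool])
           (erule local[OF that(1)] local[OF that(2)])+
      then show ?thesis using True p that by simp
    next
      case False
      have "mean Q W (\<lambda>\<sigma>. ?Y v \<sigma> * ?Y v' \<sigma>) \<le> mean Q W (?Y v)"
        by (intro mean_mono) auto
      then have "mean Q W (\<lambda>\<sigma>. ?Y v \<sigma> * ?Y v' \<sigma>) \<le> p" using p that by simp
      moreover have "0 \<le> p * p" using p0 by simp
      ultimately have "mean Q W (\<lambda>\<sigma>. ?Y v \<sigma> * ?Y v' \<sigma>) - p * p \<le> p" by linarith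
      then show ?thesis using False by simp
    qed
    finally show ?thesis .
  qed
  have "mean Q W (\<lambda>\<sigma>. (real (card {v \<in> A. Z v \<sigma>}) - real (card A) * p)\<^sup>2)
      = mean Q W (\<lambda>\<sigma>. \<Sum>v\<in>A. \<Sum>v'\<in>A. (?Y v \<sigma> - p) * (?Y v' \<sigma> - p))"
  proof (intro mean_cong)
    fix \<sigma>
    have "real (card {v \<in> A. Z v \<sigma>}) = (\<Sum>v\<in>A. ?Y v \<sigma>)"
      using fin by (simp add: Int_def)
    then have "real (card {v \<in> A. Z v \<sigma>}) - real (card A) * p = (\<Sum>v\<in>A. ?Y v \<sigma> - p)"
      by (simp add: sum_subtractf)
    then show "(real (card {v \<in> A. Z v \<sigma>}) - real (card A) * p)\<^sup>2
        = (\<Sum>v\<in>A. \<Sum>v'\<in>A. (?Y v \<sigma> - p) * (?Y v' \<sigma> - p))"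
      by (simp add: power2_eq_square sum_product)
  qed
  also have "\<dots> = (\<Sum>v\<in>A. \<Sum>v'\<in>A. mean Q W (\<lambda>\<sigma>. (?Y v \<sigma> - p) * (?Y v' \<sigma> - p)))"
    by (simp only: mean_sum)
  also have "\<dots> \<le> (\<Sum>v\<in>A. \<Sum>v'\<in>A. of_bool (S v \<inter> S v' \<noteq> {}) * p)"
    by (intro sum_mono cov)
  also have "\<dots> = (\<Sum>v\<in>A. real (card {v' \<in> A. S v \<inter> S v' \<noteq> {}}) * p)"
    using fin by (intro sum.cong refl) (simp add: sum_distrib_right[symmetric] Int_def)
  also have "\<dots> \<le> (\<Sum>v\<in>A. real d * p)"
    by (intro sum_mono mult_right_mono) (use d p0 in auto)
  finally show ?thesis by (simp add: mult.assoc)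
qed

section \<open>Turning a partial coloring into a balanced coloring\<close>

locale balanced_instance =
  fixes n k \<Delta> :: nat and P :: "nat \<Rightarrow> 'a set" and V :: "'a set" and E :: "'a set set"
  assumes balanced_partite: "balanced_partite_hypergraph n k P V E"
    and k_ge_2: "k \<ge> 2"
    and degree_le: "\<And>v. v \<in> V \<Longrightarrow> vertex_degree E v \<le> \<Delta>"
begin

lemma finite_V: "finite V"
  and edge_subset: "e \<in> E \<Longrightarrow> e \<subseteq> V"
  and card_edge: "e \<in> E \<Longrightarrow> card e = k"
  and V_eq: "V = (\<Union>i\<in>{1..k}. P i)"
  and card_part: "i \<in> {1..k} \<Longrightarrow> card (P i) = n"
  and card_edge_part: "e \<in> E \<Longrightarrow> i \<in> {1..k} \<Longrightarrow> card (e \<inter> P i) = 1"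
  and disjoint_parts: "disjoint_family_on P {1..k}"
  using balanced_partite
  by (auto simp: balanced_partite_hypergraph_def partite_hypergraph_def
      uniform_hypergraph_def hypergraph_def)

lemma finite_E: "finite E"
  using finite_V edge_subset by (intro finite_subset[of E "Pow V"]) auto

lemma part_subset: "i \<in> {1..k} \<Longrightarrow> P i \<subseteq> V"
  using V_eq by blast

lemma finite_part: "i \<in> {1..k} \<Longrightarrow> finite (P i)"
  using part_subset finite_V finite_subset by blast

lemma finite_edge: "e \<in> E \<Longrightarrow> finite e"
  using edge_subset finite_V finite_subset by blast

lemma part_unique: "v \<in> P i \<Longrightarrow> v \<in> P j \<Longrightarrow> i \<in> {1..k} \<Longrightarrow> j \<in> {1..k} \<Longrightarrow> i = j"
  using disjoint_parts by (metis IntI disjoint_family_onD empty_iff)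

lemma edge_meets_part: "e \<in> E \<Longrightarrow> i \<in> {1..k} \<Longrightarrow> \<exists>x. x \<in> e \<and> x \<in> P i"
  using card_edge_part[of e i] by (metis IntE card_eq_0_iff ex_in_conv one_neq_zero)

lemma card_edges_at_le: "v \<in> V \<Longrightarrow> card {e \<in> E. v \<in> e} \<le> \<Delta>"
  using degree_le by (simp add: vertex_degree_def)

lemma card_Union_edges_at_le:
  assumes "v \<in> V"
  shows "card (\<Union>{e \<in> E. v \<in> e}) \<le> k * \<Delta>"
proof -
  have "card (\<Union>{e \<in> E. v \<in> e}) \<le> (\<Sum>e\<in>{e \<in> E. v \<in> e}. card e)"
    by (rule card_Union_le_sum_card)
  also have "\<dots> = (\<Sum>e\<in>{e \<in> E. v \<in> e}. k)"
    by (intro sum.cong) (auto simp: card_edge)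
  also have "\<dots> \<le> k * \<Delta>"
    using card_edges_at_le[OF assms] by simp
  finally show ?thesis .
qed

text \<open>
  A coloring is balanced as soon as the parts can be numbered by a common index set in such a way that
  the color depends on the index only. An index is thought of as a column that holds one vertex of each part.
\<close>
lemma balanced_coloring_of_columns:
  assumes bij: "\<And>i. i \<in> {1..k} \<Longrightarrow> bij_betw (G i) Z (P i)"
    and range: "\<And>z. z \<in> Z \<Longrightarrow> \<kappa> z \<in> {1..q}"
    and indep: "\<And>e c. e \<in> E \<Longrightarrow> c \<in> {1..q} \<Longrightarrow> \<exists>i\<in>{1..k}. \<forall>z\<in>Z. \<kappa> z = c \<longrightarrow> G i z \<notin> e"
  shows "\<exists>\<phi>. balanced_coloring k P V E q \<phi>"
proof -
  define part where "part v = (THE i. i \<in> {1..k} \<and> v \<in> P i)" for v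
  define \<phi> where "\<phi> v = \<kappa> (inv_into Z (G (part v)) v)" for v
  have part: "part v = i" if "i \<in> {1..k}" "v \<in> P i" for v i
    unfolding part_def using that part_unique by (intro the_equality) auto
  have G_in: "G i z \<in> P i" if "i \<in> {1..k}" "z \<in> Z" for i z
    using bij that by (auto simp: bij_betw_def)
  have \<phi>_G: "\<phi> (G i z) = \<kappa> z" if "i \<in> {1..k}" "z \<in> Z" for i z
    using part[OF that(1) G_in[OF that]] bij[OF that(1)] that
    by (simp add: \<phi>_def bij_betw_def)
  have G_surj: "\<exists>z\<in>Z. v = G i z" if "i \<in> {1..k}" "v \<in> P i" for i v
    using bij[OF that(1)] that by (auto simp: bij_betw_def)
  have count: "card ({v \<in> V. \<phi> v = c} \<inter> P i) = card {z \<in> Z. \<kappa> z = c}" if "i \<in> {1..k}" for c i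
  proof -
    have "{v \<in> V. \<phi> v = c} \<inter> P i = G i ` {z \<in> Z. \<kappa> z = c}"
      using that G_in G_surj \<phi>_G part_subset by fastforce
    moreover have "inj_on (G i) {z \<in> Z. \<kappa> z = c}"
      using bij[OF that] by (auto simp: bij_betw_def inj_on_def)
    ultimately show ?thesis by (simp add: card_image)
  qed
  have "balanced_coloring k P V E q \<phi>"
    unfolding balanced_coloring_def balanced_independent_set_def independent_set_def
  proof (intro conjI ballI)
    fix v assume "v \<in> V"
    then obtain i where "i \<in> {1..k}" "v \<in> P i" using V_eq by auto
    then show "\<phi> v \<in> {1..q}" using G_surj \<phi>_G range by metis
  next
    fix c e assume c: "c \<in> {1..q}" and e: "e \<in> E"
    from indep[OF e c] obtain i where i: "i \<in> {1..k}" "\<forall>z\<in>Z. \<kappa> z = c \<longrightarrow> G i z \<notin> e" by auto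
    from edge_meets_part[OF e i(1)] obtain x where x: "x \<in> e" "x \<in> P i" by auto
    show "\<not> e \<subseteq> {v \<in> V. \<phi> v = c}"
      using G_surj[OF i(1) x(2)] x i \<phi>_G[OF i(1)] by auto
  qed (simp_all add: count)
  then show ?thesis by blast
qed

text \<open>
  The repair step: \<open>F\<close> is a coloring outside \<open>B\<close>, and \<open>t c\<close> vertices of color \<open>c\<close> are kept in each part.
  If \<open>u\<close> vertices of each part are discarded, then \<open>(k - 1) * u\<close> columns are dissolved, and at most \<open>k ^ 3 * \<Delta> * u\<close>
  others are unusable because they meet a neighbor of a discarded vertex. The last hypothesis says that these
  columns and the discarded vertices fit into a part.
\<close>
lemma balanced_coloring_of_partial_coloring:
  assumes t: "\<And>i c. i \<in> {1..k} \<Longrightarrow> c < q \<Longrightarrow> t c \<le> card {v \<in> P i. v \<notin> B \<and> F v = c}"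
    and indep: "\<And>e c. e \<in> E \<Longrightarrow> c < q \<Longrightarrow> \<not> (\<forall>v\<in>e. v \<notin> B \<and> F v = c)"
    and size: "(n - (\<Sum>c<q. t c)) * (k + k ^ 3 * \<Delta>) \<le> n"
  shows "\<exists>\<phi>. balanced_coloring k P V E (q + k) \<phi>"
proof -
  \<comment> \<open>\<open>I\<close> indexes the monochromatic columns that are kept, \<open>J\<close> the discarded vertices of each part;
    \<open>h i\<close> and \<open>r i\<close> place them into part \<open>i\<close>.\<close>
  define I where "I = (SIGMA c:{..<q}. {..<t c})"
  define u where "u = n - card I"
  define J where "J = {..<u}"
  have finI: "finite I" by (simp add: I_def)
  have cardI: "card I = (\<Sum>c<q. t c)" by (simp add: I_def)
  have "\<forall>i\<in>{1..k}. \<exists>h. inj_on h I \<and> (\<forall>z\<in>I. h z \<in> P i - B \<and> F (h z) = fst z)"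
  proof
    fix i assume i: "i \<in> {1..k}"
    have "\<forall>c\<in>{..<q}. \<exists>g. g ` {..<t c} \<subseteq> {v \<in> P i. v \<notin> B \<and> F v = c} \<and> inj_on g {..<t c}"
      using t[OF i] finite_part[OF i] by (intro ballI card_le_inj) auto
    from bchoice[OF this] obtain g where g: "\<forall>c\<in>{..<q}.
        g c ` {..<t c} \<subseteq> {v \<in> P i. v \<notin> B \<and> F v = c} \<and> inj_on (g c) {..<t c}" ..
    define f where "f z = g (fst z) (snd z)" for z
    have fP: "f z \<in> P i - B \<and> F (f z) = fst z" if "z \<in> I" for z
      using that bspec[OF g, of "fst z"] by (auto simp: I_def f_def image_subset_iff)
    moreover have "inj_on f I"
    proof (rule inj_onI)
      fix z z' assume *: "z \<in> I" "z' \<in> I" "f z = f z'"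
      then have "fst z = fst z'" using fP by metis
      moreover from this have "snd z = snd z'"
        using * g by (auto simp: I_def f_def inj_on_def)
      ultimately show "z = z'" by (rule prod_eqI)
    qed
    ultimately show "\<exists>h. inj_on h I \<and> (\<forall>z\<in>I. h z \<in> P i - B \<and> F (h z) = fst z)" by blast
  qed
  from bchoice[OF this] obtain h where h_inj: "\<And>i. i \<in> {1..k} \<Longrightarrow> inj_on (h i) I"
    and h: "\<And>i z. i \<in> {1..k} \<Longrightarrow> z \<in> I \<Longrightarrow> h i z \<in> P i - B \<and> F (h i z) = fst z"
    by blast
  have hP: "h i ` I \<subseteq> P i" if "i \<in> {1..k}" for i using h[OF that] by auto
  have one: "1 \<in> {1..k}" using k_ge_2 by auto
  have cardI_le: "card I \<le> n"
    using card_inj_on_le[OF h_inj[OF one] hP[OF one]] finite_part card_part one by simp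
  have rest: "card (P i - h i ` I) = u" if "i \<in> {1..k}" for i
    using that hP h_inj card_part finI by (simp add: card_Diff_subset card_image u_def)
  have "\<forall>i\<in>{1..k}. \<exists>r. bij_betw r J (P i - h i ` I)"
    using rest finite_part by (intro ballI finite_same_card_bij) (auto simp: J_def)
  from bchoice[OF this] obtain r
    where r: "\<And>i. i \<in> {1..k} \<Longrightarrow> bij_betw (r i) J (P i - h i ` I)" by blast
  \<comment> \<open>\<open>U\<close> is the set of discarded vertices, \<open>N\<close> its neighborhood, and \<open>D\<close> the set of columns meeting \<open>N\<close>.\<close>
  define U where "U = (\<Union>i\<in>{1..k}. P i - h i ` I)"
  define N where "N = (\<Union>x\<in>U. \<Union>{e \<in> E. x \<in> e})"
  have UV: "U \<subseteq> V" unfolding U_def using part_subset by blast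
  have finU: "finite U" using UV finite_V finite_subset by blast
  have "card U \<le> (\<Sum>i\<in>{1..k}. card (P i - h i ` I))"
    unfolding U_def by (rule card_UN_le) simp
  also have "\<dots> = k * u" using rest by simp
  finally have cardU: "card U \<le> k * u" .
  have "card N \<le> (\<Sum>x\<in>U. card (\<Union>{e \<in> E. x \<in> e}))"
    unfolding N_def by (rule card_UN_le[OF finU])
  also have "\<dots> \<le> (\<Sum>x\<in>U. k * \<Delta>)"
    using UV by (intro sum_mono card_Union_edges_at_le) auto
  also have "\<dots> = card U * (k * \<Delta>)" by simp
  also have "\<dots> \<le> k * u * (k * \<Delta>)" by (intro mult_right_mono cardU) simp
  finally have cardN: "card N \<le> k * u * (k * \<Delta>)" .
  have finN: "finite N"
    using finU finite_E finite_edge by (auto simp: N_def)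
  define D where "D = (\<Union>i\<in>{1..k}. {z \<in> I. h i z \<in> N})"
  have "card D \<le> (\<Sum>i\<in>{1..k}. card {z \<in> I. h i z \<in> N})"
    unfolding D_def by (rule card_UN_le) simp
  also have "\<dots> \<le> (\<Sum>i\<in>{1..k}. card N)"
  proof (rule sum_mono)
    fix i assume "i \<in> {1..k}"
    then have "inj_on (h i) {z \<in> I. h i z \<in> N}" using h_inj by (auto simp: inj_on_def)
    then show "card {z \<in> I. h i z \<in> N} \<le> card N"
      by (rule card_inj_on_le) (use finN in auto)
  qed
  also have "\<dots> = k * card N" by simp
  also have "\<dots> \<le> k * (k * u * (k * \<Delta>))" using cardN by simp
  finally have cardD: "card D \<le> u * (k ^ 3 * \<Delta>)"
    by (simp add: power3_eq_cube mult_ac)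
  have DI: "D \<subseteq> I" by (auto simp: D_def)
  have "(k - 1) * u + card D + u \<le> n"
  proof -
    have "(k - 1) * u + u = k * u" using k_ge_2 by (simp add: algebra_simps)
    moreover have "u * (k + k ^ 3 * \<Delta>) \<le> n" using size unfolding u_def cardI .
    then have "k * u + u * (k ^ 3 * \<Delta>) \<le> n" by (simp add: distrib_left mult.commute)
    ultimately show ?thesis using cardD by linarith
  qed
  moreover have "n = card I + u" using cardI_le by (simp add: u_def)
  ultimately have "(k - 1) * u \<le> card (I - D)"
    using DI finI by (simp add: card_Diff_subset finite_subset)
  then obtain R where R: "R \<subseteq> I - D" "card R = (k - 1) * u" "finite R"
    using obtain_subset_with_card_n by blast
  have "\<forall>i\<in>{1..k}. \<exists>\<rho>. bij_betw \<rho> (J \<times> ({1..k} - {i})) R"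
    using R by (intro ballI finite_same_card_bij) (auto simp: J_def card_cartesian_product)
  from bchoice[OF this] obtain \<rho>
    where \<rho>: "\<And>i. i \<in> {1..k} \<Longrightarrow> bij_betw (\<rho> i) (J \<times> ({1..k} - {i})) R" by blast
  \<comment> \<open>The columns in \<open>R\<close> are dissolved. Every \<open>x\<close> in \<open>J\<close> gives rise to \<open>k\<close> new columns \<open>Inr (x, j)\<close> with the new
    color \<open>q + j\<close>: in part \<open>j\<close> such a column holds a discarded vertex, in every other part a vertex of a
    dissolved column. The old colors \<open>0, \<dots>, q - 1\<close> become \<open>1, \<dots>, q\<close>.\<close>
  define Z where "Z = (I - R) <+> (J \<times> {1..k})"
  define G where "G i z = (case z of Inl y \<Rightarrow> h i y |
      Inr (x, j) \<Rightarrow> if j = i then r i x else h i (\<rho> i (x, j)))" for i z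
  define \<kappa> where "\<kappa> z = (case z of Inl y \<Rightarrow> fst y + 1 | Inr (x, j) \<Rightarrow> q + j)" for z :: "nat \<times> nat + nat \<times> nat"
  have finZ: "finite Z" by (simp add: Z_def finI J_def)
  have "card Z = card (I - R) + u * k"
    by (simp add: Z_def card_Plus finI J_def)
  also have "\<dots> = n"
  proof -
    have "card (I - R) = card I - card R" using R by (intro card_Diff_subset) auto
    moreover have "card R \<le> card I" using R finI by (intro card_mono) auto
    moreover have "u * k = (k - 1) * u + u" using k_ge_2 by (simp add: algebra_simps)
    ultimately show ?thesis using R(2) \<open>n = card I + u\<close> by simp
  qed
  finally have cardZ: "card Z = n" .
  have bij_G: "bij_betw (G i) Z (P i)" if i: "i \<in> {1..k}" for i
  proof -
    have "G i ` Z = h i ` (I - R) \<union> (r i ` J \<union> h i ` (\<rho> i ` (J \<times> ({1..k} - {i}))))"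
    proof -
      have "J \<times> {1..k} = J \<times> {i} \<union> J \<times> ({1..k} - {i})" using i by auto
      then have "Z = Inl ` (I - R) \<union> (Inr ` (J \<times> {i}) \<union> Inr ` (J \<times> ({1..k} - {i})))"
        by (auto simp: Z_def Plus_def)
      moreover have "G i ` Inl ` (I - R) = h i ` (I - R)"
        by (simp add: image_image G_def)
      moreover have "G i ` Inr ` (J \<times> {i}) = r i ` J"
        by (force simp: image_image G_def)
      moreover have "G i ` Inr ` (J \<times> ({1..k} - {i})) = h i ` (\<rho> i ` (J \<times> ({1..k} - {i})))"
        unfolding image_image by (intro image_cong) (auto simp: G_def split: if_splits)
      ultimately show ?thesis by (simp only: image_Un)
    qed
    also have "\<dots> = h i ` (I - R) \<union> ((P i - h i ` I) \<union> h i ` R)"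
      using \<rho>[OF i] r[OF i] by (simp add: bij_betw_def)
    also have "\<dots> = P i" using R(1) hP[OF i] by blast
    finally have im: "G i ` Z = P i" .
    have "inj_on (G i) Z"
      using finZ im cardZ card_part[OF i] by (intro eq_card_imp_inj_on) auto
    then show ?thesis using im by (simp add: bij_betw_def)
  qed
  show ?thesis
  proof (rule balanced_coloring_of_columns[OF bij_G])
    fix z assume "z \<in> Z"
    then show "\<kappa> z \<in> {1..q + k}" by (auto simp: Z_def \<kappa>_def I_def)
  next
    fix e c assume e: "e \<in> E" and c: "c \<in> {1..q + k}"
    show "\<exists>i\<in>{1..k}. \<forall>z\<in>Z. \<kappa> z = c \<longrightarrow> G i z \<notin> e"
    proof (rule ccontr)
      assume "\<not> ?thesis"
      then have all: "\<exists>z\<in>Z. \<kappa> z = c \<and> G i z \<in> e" if "i \<in> {1..k}" for i using that by blast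
      have GP: "G i z \<in> P i" if "i \<in> {1..k}" "z \<in> Z" for i z
        using bij_betwE[OF bij_G[OF that(1)]] that(2) by blast
      have the_vertex: "v = x" if "v \<in> e" "x \<in> e" "v \<in> P i" "x \<in> P i" "i \<in> {1..k}" for v x i
        using card_edge_part[OF e that(5)] that by (metis IntI card_1_singletonE singletonD)
      show False
      proof (cases "c \<le> q")
        case True
        have "v \<notin> B \<and> F v = c - 1" if v: "v \<in> e" for v
        proof -
          obtain i where i: "i \<in> {1..k}" "v \<in> P i" using v edge_subset[OF e] V_eq by auto
          obtain z where z: "z \<in> Z" "\<kappa> z = c" "G i z \<in> e" using all[OF i(1)] by auto
          have "v = G i z" using the_vertex v z i GP by blast
          moreover obtain y where "z = Inl y" "y \<in> I" "fst y = c - 1"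
            using z True by (auto simp: Z_def \<kappa>_def)
          ultimately show ?thesis using h[OF i(1), of y] by (simp add: G_def)
        qed
        moreover have "c - 1 < q" using True c by auto
        ultimately show False using indep[OF e] by blast
      next
        case False
        define j where "j = c - q"
        have j: "j \<in> {1..k}" using False c by (auto simp: j_def)
        have new: "\<exists>x\<in>J. z = Inr (x, j)" if "z \<in> Z" "\<kappa> z = c" for z
          using that False by (auto simp: Z_def \<kappa>_def j_def I_def)
        obtain z where z: "z \<in> Z" "\<kappa> z = c" "G j z \<in> e" using all[OF j] by blast
        then obtain x where x: "x \<in> J" "r j x \<in> e" using new[OF z(1,2)] by (auto simp: G_def)
        have "r j x \<in> P j - h j ` I" using bij_betwE[OF r[OF j]] x(1) by blast
        then have rU: "r j x \<in> U" unfolding U_def using j by blast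
        define i where "i = (if j = 1 then 2 else 1 :: nat)"
        have i: "i \<in> {1..k}" "i \<noteq> j" using k_ge_2 by (auto simp: i_def)
        obtain z' where z': "z' \<in> Z" "\<kappa> z' = c" "G i z' \<in> e" using all[OF i(1)] by blast
        then obtain x' where x': "x' \<in> J" "h i (\<rho> i (x', j)) \<in> e"
          using new[OF z'(1,2)] i(2) by (auto simp: G_def)
        have "\<rho> i (x', j) \<in> R" using bij_betwE[OF \<rho>[OF i(1)]] x'(1) i j by auto
        then have "\<rho> i (x', j) \<in> I - D" using R(1) by blast
        then have "h i (\<rho> i (x', j)) \<notin> N" using i(1) by (auto simp: D_def)
        then show False using x' x(2) rU e by (auto simp: N_def)
      qed
    qed
  qed
qed

end

section \<open>A random coloring that treats all colors alike\<close>

text \<open>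
  The first element of \<open>A\<close> in the cyclic order \<open>r, r + 1, \<dots>, q - 1, 0, \<dots>, r - 1\<close>. For empty \<open>A\<close> it is a rotation of \<open>r\<close>
  by a constant, because \<open>LEAST\<close> then denotes a number that depends on nothing; the rule thus commutes
  with rotations in this case as well.
\<close>
definition first_from :: "nat \<Rightarrow> nat set \<Rightarrow> nat \<Rightarrow> nat" where
  "first_from q A r = (r + (LEAST t. (r + t) mod q \<in> A)) mod q"

lemma first_from_in:
  assumes "c \<in> A" "c < q" "r < q"
  shows "first_from q A r \<in> A"
proof -
  have "(r + (c + q - r)) mod q = c" using assms by simp
  then have "(r + (c + q - r)) mod q \<in> A" using assms by simp
  then show ?thesis unfolding first_from_def by (rule LeastI)
qed

lemma first_from_rotate:
  assumes "\<And>c. (c + s) mod q \<in> A' \<longleftrightarrow> c mod q \<in> A"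
  shows "first_from q A' ((r + s) mod q) = (first_from q A r + s) mod q"
proof -
  have shift: "((r + s) mod q + t) mod q = (r + t + s) mod q" for t
    by (subst mod_add_left_eq) (simp add: ac_simps)
  have "((r + s) mod q + t) mod q \<in> A' \<longleftrightarrow> (r + t) mod q \<in> A" for t
    using assms[of "r + t"] shift by simp
  then have "first_from q A' ((r + s) mod q) = ((r + s) mod q + (LEAST t. (r + t) mod q \<in> A)) mod q"
    by (simp only: first_from_def)
  also have "\<dots> = (first_from q A r + s) mod q"
    unfolding shift first_from_def by (rule mod_add_left_eq[symmetric])
  finally show ?thesis .
qed

lemma mean_rotate:
  fixes s q :: nat
  assumes "s < q"
  shows "mean {..<q} V (\<lambda>\<sigma>. f (\<lambda>x\<in>V. (\<sigma> x + s) mod q)) = mean {..<q} V f"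
proof -
  have cancel: "((y + s) mod q + (q - s)) mod q = y" "((y + (q - s)) mod q + s) mod q = y" if "y < q" for y
  proof -
    have "y + s + (q - s) = y + q" "y + (q - s) + s = y + q" using assms by auto
    then show "((y + s) mod q + (q - s)) mod q = y" "((y + (q - s)) mod q + s) mod q = y"
      unfolding mod_add_left_eq using that by simp_all
  qed
  have "(\<Sum>\<sigma>\<in>V \<rightarrow>\<^sub>E {..<q}. f (\<lambda>x\<in>V. (\<sigma> x + s) mod q)) = (\<Sum>\<sigma>\<in>V \<rightarrow>\<^sub>E {..<q}. f \<sigma>)"
    by (rule sum.reindex_bij_witness[of _ "\<lambda>\<sigma>. \<lambda>x\<in>V. (\<sigma> x + (q - s)) mod q"
          "\<lambda>\<sigma>. \<lambda>x\<in>V. (\<sigma> x + s) mod q"])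
       (use assms cancel in \<open>auto simp: fun_eq_iff PiE_iff extensional_def restrict_def\<close>)
  then show ?thesis by (simp add: mean_def)
qed

lemma eq_of_add_mod_eq:
  fixes x y s q :: nat
  assumes "(x + s) mod q = (y + s) mod q" "x < q" "y < q"
  shows "x = y"
  using assms
proof (induction x y rule: linorder_wlog)
  case (le x y)
  then have "q dvd y - x" using mod_eq_dvd_iff_nat[of "x + s" "y + s" q] by simp
  then show ?case using le by (metis dvd_imp_le diff_is_0_eq le_antisym less_imp_diff_less not_gr_zero not_less)
qed auto

context balanced_instance
begin

definition link :: "'a \<Rightarrow> 'a set set" where
  "link v = (\<lambda>e. e - {v}) ` {e \<in> E. v \<in> e}"

definition available :: "nat \<Rightarrow> ('a \<Rightarrow> nat) \<Rightarrow> 'a \<Rightarrow> nat set" where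
  "available q \<sigma> v = {c \<in> {..<q}. \<forall>l\<in>link v. \<not> l \<subseteq> {x \<in> V. \<sigma> x = c}}"

text \<open>
  A random \<open>\<sigma>\<close> is used in two ways: outside the last part it is the color itself, on the last part it is the
  starting point of the cyclic search for an available color.
\<close>
definition color :: "nat \<Rightarrow> ('a \<Rightarrow> nat) \<Rightarrow> 'a \<Rightarrow> nat" where
  "color q \<sigma> v = (if v \<in> P k then first_from q (available q \<sigma> v) (\<sigma> v) else \<sigma> v)"

definition nbhd :: "'a \<Rightarrow> 'a set" where
  "nbhd v = insert v (\<Union>{e \<in> E. v \<in> e})"

lemma k_part: "k \<in> {1..k}" using k_ge_2 by auto

lemma nbhd_subset: "v \<in> V \<Longrightarrow> nbhd v \<subseteq> V"
  using edge_subset by (auto simp: nbhd_def)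

lemma nbhd_sym: "x \<in> nbhd v \<Longrightarrow> v \<in> nbhd x"
  by (auto simp: nbhd_def)

lemma card_nbhd_le: "v \<in> V \<Longrightarrow> card (nbhd v) \<le> 1 + k * \<Delta>"
  using card_Union_edges_at_le[of v] card_insert_le_m1[of "1 + k * \<Delta>" "\<Union>{e \<in> E. v \<in> e}" v]
  by (simp add: nbhd_def)

lemma card_overlapping_nbhd_le:
  assumes "v \<in> V" "A \<subseteq> V"
  shows "card {v' \<in> A. nbhd v \<inter> nbhd v' \<noteq> {}} \<le> (1 + k * \<Delta>)\<^sup>2"
proof -
  have fin: "finite (nbhd x)" if "x \<in> V" for x
    using nbhd_subset[OF that] finite_V finite_subset by blast
  have "card {v' \<in> A. nbhd v \<inter> nbhd v' \<noteq> {}} \<le> card (\<Union>x\<in>nbhd v. nbhd x)"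
    using nbhd_sym nbhd_subset assms fin by (intro card_mono finite_UN_I) blast+
  also have "\<dots> \<le> (\<Sum>x\<in>nbhd v. card (nbhd x))"
    by (rule card_UN_le[OF fin[OF assms(1)]])
  also have "\<dots> \<le> (\<Sum>x\<in>nbhd v. 1 + k * \<Delta>)"
    using nbhd_subset[OF assms(1)] by (intro sum_mono card_nbhd_le) auto
  also have "\<dots> = card (nbhd v) * (1 + k * \<Delta>)" by simp
  also have "\<dots> \<le> (1 + k * \<Delta>) * (1 + k * \<Delta>)"
    by (intro mult_right_mono card_nbhd_le assms) simp
  finally show ?thesis by (simp only: power2_eq_square)
qed

lemma color_local:
  assumes "\<And>x. x \<in> nbhd v \<Longrightarrow> \<sigma> x = \<sigma>' x"
  shows "color q \<sigma> v = color q \<sigma>' v"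
proof -
  have "l \<subseteq> {x \<in> V. \<sigma> x = c} \<longleftrightarrow> l \<subseteq> {x \<in> V. \<sigma>' x = c}" if "l \<in> link v" for l c
  proof -
    have "l \<subseteq> nbhd v" using that by (auto simp: link_def nbhd_def)
    then have "\<forall>x\<in>l. \<sigma> x = \<sigma>' x" using assms by blast
    then show ?thesis by (simp add: subset_iff)
  qed
  then have "available q \<sigma> v = available q \<sigma>' v" by (auto simp: available_def)
  moreover have "\<sigma> v = \<sigma>' v" using assms by (simp add: nbhd_def)
  ultimately show ?thesis by (simp add: color_def)
qed

lemma color_lt: "\<sigma> \<in> V \<rightarrow>\<^sub>E {..<q} \<Longrightarrow> v \<in> V \<Longrightarrow> color q \<sigma> v < q"
  by (force simp: color_def first_from_def PiE_iff intro!: mod_less_divisor)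

lemma color_rotate:
  assumes \<sigma>: "\<sigma> \<in> V \<rightarrow>\<^sub>E {..<q}" and v: "v \<in> V" and "q > 0"
  shows "color q (\<lambda>x\<in>V. (\<sigma> x + s) mod q) v = (color q \<sigma> v + s) mod q"
proof -
  let ?\<sigma> = "\<lambda>x\<in>V. (\<sigma> x + s) mod q"
  have "{x \<in> V. ?\<sigma> x = (c + s) mod q} = {x \<in> V. \<sigma> x = c mod q}" for c
  proof -
    have "(\<sigma> x + s) mod q = (c + s) mod q \<longleftrightarrow> \<sigma> x = c mod q" if "x \<in> V" for x
      using eq_of_add_mod_eq[of "\<sigma> x" s q "c mod q"] that \<sigma> \<open>q > 0\<close>
      by (auto simp: mod_add_left_eq PiE_iff)
    then show ?thesis by auto
  qed
  then have "(c + s) mod q \<in> available q ?\<sigma> v \<longleftrightarrow> c mod q \<in> available q \<sigma> v" for c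
    using \<open>q > 0\<close> by (simp add: available_def)
  from first_from_rotate[OF this] show ?thesis using v by (simp add: color_def)
qed

text \<open>
  Rotating \<open>\<sigma>\<close> by \<open>s\<close> preserves the uniform distribution and moves the color \<open>0\<close> of \<open>v\<close> to \<open>s\<close>, so all colors are
  equally likely; the vertices without available color are included.
\<close>
lemma color_uniform:
  assumes v: "v \<in> V" and c: "c < q"
  shows "mean {..<q} V (\<lambda>\<sigma>. of_bool (color q \<sigma> v = c)) = 1 / real q"
proof -
  have q: "q > 0" using c by simp
  have eq: "mean {..<q} V (\<lambda>\<sigma>. of_bool (color q \<sigma> v = s)) = mean {..<q} V (\<lambda>\<sigma>. of_bool (color q \<sigma> v = 0))"
    if s: "s < q" for s
  proof -
    have "mean {..<q} V (\<lambda>\<sigma>. of_bool (color q \<sigma> v = s))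
        = mean {..<q} V (\<lambda>\<sigma>. of_bool (color q (\<lambda>x\<in>V. (\<sigma> x + s) mod q) v = s))"
      by (rule mean_rotate[OF s, symmetric])
    also have "\<dots> = mean {..<q} V (\<lambda>\<sigma>. of_bool (color q \<sigma> v = 0))"
    proof (intro mean_cong arg_cong[where f = of_bool])
      fix \<sigma> assume \<sigma>: "\<sigma> \<in> V \<rightarrow>\<^sub>E {..<q}"
      show "(color q (\<lambda>x\<in>V. (\<sigma> x + s) mod q) v = s) = (color q \<sigma> v = 0)"
        using color_rotate[OF \<sigma> v q] eq_of_add_mod_eq[of "color q \<sigma> v" s q 0] color_lt[OF \<sigma> v] s q
        by auto
    qed
    finally show ?thesis .
  qed
  have "1 = mean {..<q} V (\<lambda>\<sigma>. \<Sum>s<q. of_bool (color q \<sigma> v = s))"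
  proof -
    have "mean {..<q} V (\<lambda>\<sigma>. \<Sum>s<q. of_bool (color q \<sigma> v = s)) = mean {..<q} V (\<lambda>\<sigma>. 1)"
      using color_lt[OF _ v] by (intro mean_cong) (simp add: of_bool_def)
    then show ?thesis using q finite_V by (simp add: mean_const lessThan_empty_iff)
  qed
  also have "\<dots> = (\<Sum>s<q. mean {..<q} V (\<lambda>\<sigma>. of_bool (color q \<sigma> v = 0)))"
    unfolding mean_sum by (intro sum.cong eq) auto
  also have "\<dots> = real q * mean {..<q} V (\<lambda>\<sigma>. of_bool (color q \<sigma> v = c))"
    using eq[OF c] by simp
  finally show ?thesis using q by (simp add: field_simps)
qed

text \<open>
  A color is unavailable at \<open>v\<close> exactly if its class contains a member of the link of \<open>v\<close>; the link has at most
  \<open>\<Delta>\<close> members, each with \<open>k - 1\<close> vertices.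
\<close>
lemma no_available_color_le:
  assumes "v \<in> V" "q > 0"
  shows "mean {..<q} V (\<lambda>\<sigma>. of_bool (available q \<sigma> v = {}))
    \<le> (1 - (1 - 1 / real q ^ (k - 1)) ^ \<Delta>) ^ q"
proof -
  have "card (link v) \<le> card {e \<in> E. v \<in> e}"
    unfolding link_def using finite_E by (intro card_image_le) auto
  then have card: "card (link v) \<le> \<Delta>" using card_edges_at_le[OF assms(1)] by simp
  have "mean {..<q} V (\<lambda>\<sigma>. of_bool (available q \<sigma> v = {}))
      = mean {..<q} V (\<lambda>\<sigma>. of_bool (\<forall>c\<in>{..<q}. \<exists>l\<in>link v. l \<subseteq> {x \<in> V. \<sigma> x = c}))"
    by (intro mean_cong arg_cong[where f = of_bool]) (auto simp: available_def)
  also have "\<dots> \<le> (1 - (1 - 1 / real (card {..<q}) ^ (k - 1)) ^ \<Delta>) ^ card {..<q}"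
    using finite_V assms(2) edge_subset finite_E card card_edge finite_edge
    by (intro mean_every_class_hit_le) (auto simp: link_def)
  finally show ?thesis by simp
qed

text \<open>
  The vertex of the edge in the last part avoids the color of its \<open>k - 1\<close> companions, should these agree.
\<close>
lemma color_not_constant_on_edge:
  assumes \<sigma>: "\<sigma> \<in> V \<rightarrow>\<^sub>E {..<q}" and e: "e \<in> E"
  shows "\<not> (\<forall>v\<in>e. v \<notin> {v \<in> P k. available q \<sigma> v = {}} \<and> color q \<sigma> v = c)"
proof
  assume all: "\<forall>v\<in>e. v \<notin> {v \<in> P k. available q \<sigma> v = {}} \<and> color q \<sigma> v = c"
  obtain v where v: "v \<in> e" "v \<in> P k" using edge_meets_part[OF e k_part] by auto
  then obtain a where "a \<in> available q \<sigma> v" using all by auto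
  moreover have "\<sigma> v < q" using \<sigma> v e edge_subset by (auto simp: PiE_iff)
  ultimately have "c \<in> available q \<sigma> v"
    using first_from_in[of a "available q \<sigma> v" q "\<sigma> v"] v all by (auto simp: color_def available_def)
  moreover have "e - {v} \<in> link v" using v e by (auto simp: link_def)
  ultimately obtain x where x: "x \<in> e" "x \<noteq> v" "\<not> (x \<in> V \<and> \<sigma> x = c)"
    unfolding available_def by blast
  then have "x \<in> P k" using all e edge_subset by (auto simp: color_def split: if_splits)
  then have "x \<in> e \<inter> P k" "v \<in> e \<inter> P k" using v x by simp_all
  then have "x = v" using card_edge_part[OF e k_part] by (metis card_1_singletonE singletonD)
  then show False using x by simp
qed

text \<open>
  Both random quantities are nonnegative and their means are bounded, so some outcome exceeds neither
  bound by more than a factor of two.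
\<close>
lemma good_random_coloring:
  fixes p :: real
  assumes q: "q > 0" and n: "n > 0" and p: "p > 0" "(1 - (1 - 1 / real q ^ (k - 1)) ^ \<Delta>) ^ q \<le> p"
  shows "\<exists>\<sigma>\<in>V \<rightarrow>\<^sub>E {..<q}.
    (\<Sum>i\<in>{1..k}. \<Sum>c<q. (real (card {v \<in> P i. color q \<sigma> v = c}) - real n / real q)\<^sup>2)
      \<le> 2 * (real k * real n * (1 + real k * real \<Delta>)\<^sup>2)
    \<and> real (card {v \<in> P k. available q \<sigma> v = {}}) \<le> 2 * (real n * p)"
proof -
  let ?Q = "{..<q}"
  note fin = finite_V finite_lessThan[of q]
  have Q: "?Q \<noteq> {}" using q by (simp add: lessThan_empty_iff)
  define d where "d = (1 + real k * real \<Delta>)\<^sup>2"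
  define X where "X \<sigma> = (\<Sum>i\<in>{1..k}. \<Sum>c<q. (real (card {v \<in> P i. color q \<sigma> v = c}) - real n / real q)\<^sup>2)" for \<sigma>
  define Y where "Y \<sigma> = real (card {v \<in> P k. available q \<sigma> v = {}})" for \<sigma>
  have "mean ?Q V X \<le> (\<Sum>i\<in>{1..k}. \<Sum>c<q. real n * d * (1 / real q))"
    unfolding X_def mean_sum
  proof (intro sum_mono)
    fix i c assume i: "i \<in> {1..k}" and "c \<in> ?Q"
    then have c: "c < q" by simp
    have "mean ?Q V (\<lambda>\<sigma>. (real (card {v \<in> P i. color q \<sigma> v = c}) - real (card (P i)) * (1 / real q))\<^sup>2)
        \<le> real (card (P i)) * real ((1 + k * \<Delta>)\<^sup>2) * (1 / real q)"
    proof (rule second_moment_le[OF fin Q finite_part[OF i], where S = nbhd])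
      fix v assume v: "v \<in> P i"
      then have vV: "v \<in> V" using part_subset[OF i] by auto
      show "mean ?Q V (\<lambda>\<sigma>. of_bool (color q \<sigma> v = c)) = 1 / real q"
        by (rule color_uniform[OF vV c])
      show "card {v' \<in> P i. nbhd v \<inter> nbhd v' \<noteq> {}} \<le> (1 + k * \<Delta>)\<^sup>2"
        by (rule card_overlapping_nbhd_le[OF vV part_subset[OF i]])
      show "(color q \<sigma> v = c) = (color q \<sigma>' v = c)"
        if "\<And>x. x \<in> nbhd v \<Longrightarrow> \<sigma> x = \<sigma>' x" for \<sigma> \<sigma>'
        using color_local[OF that] by simp
    qed
    then show "mean ?Q V (\<lambda>\<sigma>. (real (card {v \<in> P i. color q \<sigma> v = c}) - real n / real q)\<^sup>2)
        \<le> real n * d * (1 / real q)"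
      using card_part[OF i] by (simp add: d_def)
  qed
  also have "\<dots> = real k * real n * d" using q by simp
  finally have X: "mean ?Q V X \<le> real k * real n * d" .
  have "mean ?Q V Y = (\<Sum>v\<in>P k. mean ?Q V (\<lambda>\<sigma>. of_bool (available q \<sigma> v = {})))"
    unfolding mean_sum[symmetric] Y_def using finite_part[OF k_part]
    by (intro mean_cong) (simp add: Int_def)
  also have "\<dots> \<le> (\<Sum>v\<in>P k. p)"
    using part_subset[OF k_part] by (intro sum_mono order_trans[OF no_available_color_le p(2)] q) auto
  also have "\<dots> = real n * p" using card_part[OF k_part] by simp
  finally have Y: "mean ?Q V Y \<le> real n * p" .
  define a where "a = real k * real n * d"
  define b where "b = real n * p"
  have "1 + real k * real \<Delta> > 0" by (simp add: add_pos_nonneg)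
  then have a: "a > 0" using n k_ge_2 by (simp add: a_def d_def)
  have b: "b > 0" using n p by (simp add: b_def)
  \<comment> \<open>Normalized by the bounds on their means, the two quantities add up to a variable of mean at most 2.\<close>
  obtain \<sigma> where \<sigma>: "\<sigma> \<in> V \<rightarrow>\<^sub>E ?Q"
    "1 / a * X \<sigma> + 1 / b * Y \<sigma> \<le> mean ?Q V (\<lambda>\<sigma>. 1 / a * X \<sigma> + 1 / b * Y \<sigma>)"
    using mean_attained[OF fin Q, of "\<lambda>\<sigma>. 1 / a * X \<sigma> + 1 / b * Y \<sigma>"] by (rule bexE)
  note \<sigma>(2)
  also have "mean ?Q V (\<lambda>\<sigma>. 1 / a * X \<sigma> + 1 / b * Y \<sigma>) = mean ?Q V X / a + mean ?Q V Y / b"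
    unfolding mean_add mean_cmult by simp
  also have "\<dots> \<le> 1 + 1"
    using X Y a b by (intro add_mono) (auto simp: a_def b_def divide_le_eq_1)
  finally have sum: "X \<sigma> / a + Y \<sigma> / b \<le> 2" by simp
  have "X \<sigma> / a \<ge> 0" "Y \<sigma> / b \<ge> 0"
    using a b by (auto simp: X_def Y_def intro!: divide_nonneg_pos sum_nonneg)
  then have "X \<sigma> / a \<le> 2" "Y \<sigma> / b \<le> 2" using sum by linarith+
  then have "X \<sigma> \<le> 2 * a" "Y \<sigma> \<le> 2 * b" using a b by (simp_all add: pos_divide_le_eq)
  then show ?thesis using \<sigma>(1) by (auto simp: X_def Y_def a_def b_def d_def)
qed

text \<open>
  Trimming to the smallest size in any part costs, for each color, at most the sum of the \<open>k\<close> deviations from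
  \<open>n / q\<close> and the number of vertices of that color without available color. By the Cauchy-Schwarz
  inequality the deviations add up to at most the square root in the hypothesis.
\<close>
lemma balanced_coloring_exists:
  fixes p :: real
  assumes q: "q > 0" and n: "n > 0" and p: "p > 0" "(1 - (1 - 1 / real q ^ (k - 1)) ^ \<Delta>) ^ q \<le> p"
    and size: "(sqrt (real k * real q * (2 * (real k * real n * (1 + real k * real \<Delta>)\<^sup>2))) + 2 * (real n * p))
      * (real k + real k ^ 3 * real \<Delta>) \<le> real n"
  shows "\<exists>\<phi>. balanced_coloring k P V E (q + k) \<phi>"
proof -
  define a where "a = 2 * (real k * real n * (1 + real k * real \<Delta>)\<^sup>2)"
  obtain \<sigma> where \<sigma>: "\<sigma> \<in> V \<rightarrow>\<^sub>E {..<q}"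
    and dev: "(\<Sum>i\<in>{1..k}. \<Sum>c<q. (real (card {v \<in> P i. color q \<sigma> v = c}) - real n / real q)\<^sup>2) \<le> a"
    and bad: "real (card {v \<in> P k. available q \<sigma> v = {}}) \<le> 2 * (real n * p)"
    using good_random_coloring[OF q n p] unfolding a_def by blast
  define B where "B = {v \<in> P k. available q \<sigma> v = {}}"
  define s where "s i c = card {v \<in> P i. v \<notin> B \<and> color q \<sigma> v = c}" for i c
  define t where "t c = Min ((\<lambda>i. s i c) ` {1..k})" for c
  define \<delta> where "\<delta> i c = \<bar>real (card {v \<in> P i. color q \<sigma> v = c}) - real n / real q\<bar>" for i c
  have finB: "finite B" using finite_part[OF k_part] by (simp add: B_def)
  have t_le: "t c \<le> s i c" if "i \<in> {1..k}" for i c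
    unfolding t_def using that by (intro Min_le) auto
  have t_ge: "real (t c) \<ge> real n / real q - (\<Sum>i\<in>{1..k}. \<delta> i c) - real (card {v \<in> B. color q \<sigma> v = c})" for c
  proof -
    have "t c \<in> (\<lambda>i. s i c) ` {1..k}"
      unfolding t_def using k_ge_2 by (intro Min_in) auto
    then obtain i where i: "i \<in> {1..k}" "t c = s i c" by auto
    have "card {v \<in> P i. color q \<sigma> v = c}
        \<le> card ({v \<in> P i. v \<notin> B \<and> color q \<sigma> v = c} \<union> {v \<in> B. color q \<sigma> v = c})"
      using finite_part[OF i(1)] finB by (intro card_mono) auto
    also have "\<dots> \<le> t c + card {v \<in> B. color q \<sigma> v = c}"
      unfolding i(2) s_def by (rule card_Un_le)
    finally have "real (card {v \<in> P i. color q \<sigma> v = c}) \<le> real (t c) + real (card {v \<in> B. color q \<sigma> v = c})"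
      by linarith
    moreover have "\<delta> i c \<le> (\<Sum>i\<in>{1..k}. \<delta> i c)"
      using i by (intro member_le_sum) (auto simp: \<delta>_def)
    ultimately show ?thesis by (simp add: \<delta>_def)
  qed
  have "(\<Sum>c<q. card {v \<in> B. color q \<sigma> v = c}) = card B"
  proof -
    have "card B = card (\<Union>c<q. {v \<in> B. color q \<sigma> v = c})"
      using color_lt[OF \<sigma>] part_subset[OF k_part] by (intro arg_cong[where f = card]) (auto simp: B_def)
    also have "\<dots> = (\<Sum>c<q. card {v \<in> B. color q \<sigma> v = c})"
      using finB by (intro card_UN_disjoint) auto
    finally show ?thesis by simp
  qed
  then have sumB: "(\<Sum>c<q. real (card {v \<in> B. color q \<sigma> v = c})) = real (card B)"
    by (metis of_nat_sum)
  have "real n - (\<Sum>c<q. \<Sum>i\<in>{1..k}. \<delta> i c) - real (card B)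
      = (\<Sum>c<q. real n / real q - (\<Sum>i\<in>{1..k}. \<delta> i c) - real (card {v \<in> B. color q \<sigma> v = c}))"
    using q by (simp add: sum_subtractf sumB)
  also have "\<dots> \<le> (\<Sum>c<q. real (t c))" by (intro sum_mono t_ge)
  finally have loss: "real n - real (\<Sum>c<q. t c) \<le> (\<Sum>c<q. \<Sum>i\<in>{1..k}. \<delta> i c) + real (card B)"
    by simp
  have "(\<Sum>c<q. \<Sum>i\<in>{1..k}. \<delta> i c)\<^sup>2 \<le> real k * real q * a"
  proof -
    have "(\<Sum>c<q. \<Sum>i\<in>{1..k}. \<delta> i c)\<^sup>2 = (\<Sum>z\<in>{1..k} \<times> {..<q}. \<delta> (fst z) (snd z))\<^sup>2"
      by (subst sum.swap) (simp add: sum.cartesian_product case_prod_unfold)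
    also have "\<dots> \<le> (\<Sum>z\<in>{1..k} \<times> {..<q}. (\<delta> (fst z) (snd z))\<^sup>2) * real (card ({1..k} \<times> {..<q}))"
      using sum_squared_le_sum_of_squares[where I = "{1..k} \<times> {..<q}" and f = "\<lambda>z. \<delta> (fst z) (snd z)"] by simp
    also have "(\<Sum>z\<in>{1..k} \<times> {..<q}. (\<delta> (fst z) (snd z))\<^sup>2)
        = (\<Sum>i\<in>{1..k}. \<Sum>c<q. (real (card {v \<in> P i. color q \<sigma> v = c}) - real n / real q)\<^sup>2)"
      by (simp add: sum.cartesian_product case_prod_unfold \<delta>_def)
    also have "\<dots> * real (card ({1..k} \<times> {..<q})) \<le> a * real (card ({1..k} \<times> {..<q}))"
      by (intro mult_right_mono dev) simp
    finally show ?thesis by (simp add: mult.commute)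
  qed
  then have "(\<Sum>c<q. \<Sum>i\<in>{1..k}. \<delta> i c) \<le> sqrt (real k * real q * a)"
    by (rule real_le_rsqrt)
  then have u: "real n - real (\<Sum>c<q. t c) \<le> sqrt (real k * real q * a) + 2 * (real n * p)"
    using loss bad unfolding B_def by linarith
  have "real (n - (\<Sum>c<q. t c)) \<le> sqrt (real k * real q * a) + 2 * (real n * p)"
  proof (cases "(\<Sum>c<q. t c) \<le> n")
    case True
    then show ?thesis using u by (simp add: of_nat_diff)
  next
    case False
    then show ?thesis using p by (simp add: a_def)
  qed
  then have "real (n - (\<Sum>c<q. t c)) * (real k + real k ^ 3 * real \<Delta>)
      \<le> (sqrt (real k * real q * a) + 2 * (real n * p)) * (real k + real k ^ 3 * real \<Delta>)"
    by (intro mult_right_mono) auto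
  also have "\<dots> \<le> real n" using size unfolding a_def .
  finally have "real ((n - (\<Sum>c<q. t c)) * (k + k ^ 3 * \<Delta>)) \<le> real n" by simp
  then have "(n - (\<Sum>c<q. t c)) * (k + k ^ 3 * \<Delta>) \<le> n" by (simp only: of_nat_le_iff)
  then show ?thesis
    using t_le color_not_constant_on_edge[OF \<sigma>]
    by (intro balanced_coloring_of_partial_coloring[where t = t and B = B and F = "color q \<sigma>"])
       (auto simp: s_def B_def)
qed

end

section \<open>Choosing the number of colors\<close>

text \<open>
  A fixed number of extra colors fits between the bounds with slightly different constants.
\<close>
lemma eventually_powr_gap:
  fixes b c a d :: real
  assumes "0 < b" "b < c" "a > 0"
  shows "\<forall>\<^sub>F x in at_top. (b * (x / ln x)) powr a + d \<le> (c * (x / ln x)) powr a"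
proof -
  define g where "g = c powr a - b powr a"
  have "g > 0" unfolding g_def using powr_less_mono2[of a b c] assms by simp
  then have "\<forall>\<^sub>F x in at_top. d \<le> g * (x / ln x) powr a" using \<open>a > 0\<close> by real_asymp
  moreover have "\<forall>\<^sub>F x in at_top. x > (1::real)" by (rule eventually_gt_at_top)
  ultimately show ?thesis
  proof eventually_elim
    case (elim x)
    then have "x / ln x \<ge> 0" by simp
    then have "(b * (x / ln x)) powr a = b powr a * (x / ln x) powr a"
      "(c * (x / ln x)) powr a = c powr a * (x / ln x) powr a"
      using assms by (simp_all only: powr_mult)
    then show ?case using elim(1) by (simp add: g_def left_diff_distrib)
  qed
qed

lemma one_minus_power_ge:
  fixes x y :: real
  assumes "0 \<le> y" "y \<le> 1 / 2" "real D * y\<^sup>2 \<le> 1"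
  shows "exp (- (real D * y) - 2) \<le> (1 - y) ^ D"
proof -
  have "- (real D * y) - 2 \<le> real D * (- y - 2 * y\<^sup>2)"
    using assms(3) by (simp add: algebra_simps)
  also have "\<dots> \<le> real D * ln (1 - y)"
    using ln_one_minus_pos_lower_bound[OF assms(1,2)] by (intro mult_left_mono) auto
  finally have "exp (- (real D * y) - 2) \<le> exp (real D * ln (1 - y))" by simp
  also have "\<dots> = (1 - y) ^ D" using assms(2) by (simp add: exp_of_nat_mult)
  finally show ?thesis .
qed

text \<open>
  The number \<open>q\<close> is chosen such that \<open>q + k\<close> is the integer part of the bound \<open>Q\<close>. It is then at least \<open>R\<close>, the same
  expression with \<open>\<epsilon> / 2\<close>, so \<open>q ^ (k - 1)\<close> is at least \<open>b * \<Delta> / ln \<Delta>\<close>. A color is available with probability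
  at least about \<open>\<Delta> powr (- 1 / b)\<close>, and \<open>R\<close> times this quantity is a positive power of \<open>\<Delta>\<close> up to
  logarithms, because \<open>1 / b < 1 / (k - 1)\<close>.
\<close>
lemma eventually_number_of_colors:
  fixes \<epsilon> :: real and k :: nat
  assumes "\<epsilon> > 0" and "k \<ge> 2"
  shows "\<forall>\<^sub>F \<Delta> in sequentially. \<exists>q>0.
    real (q + k) \<le> ((real k - 1 + \<epsilon>) * (real \<Delta> / ln (real \<Delta>))) powr (1 / (real k - 1)) \<and>
    (1 - (1 - 1 / real q ^ (k - 1)) ^ \<Delta>) ^ q \<le> 1 / (8 * real k ^ 3 * real \<Delta>) \<and>
    128 * real k ^ 10 * real q * real \<Delta> ^ 4 \<le> real \<Delta> powr (5 + 1 / (real k - 1)) * ln (real \<Delta>)"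
proof -
  define m where "m = real k - 1"
  define a where "a = 1 / m"
  define b where "b = m + \<epsilon> / 2"
  define R where "R x = (b * (x / ln x)) powr a" for x :: real
  define Q where "Q x = ((m + \<epsilon>) * (x / ln x)) powr a" for x :: real
  define K where "K = 8 * real k ^ 3"
  define y where "y x = ln x / (b * x)" for x :: real
  have m: "m \<ge> 1" "m = real (k - 1)" using assms by (simp_all add: m_def of_nat_diff)
  have pos: "a > 0" "b > 0" "m + \<epsilon> > 0" "K > 0" "b < m + \<epsilon>"
    using m assms by (simp_all add: a_def b_def K_def)
  have "1 / b < a" using m assms by (simp add: a_def b_def field_simps)
  have gap: "\<forall>\<^sub>F x in at_top. R x + (real k + 1) \<le> Q x"
    unfolding R_def Q_def using pos by (intro eventually_powr_gap) auto
  have fail: "\<forall>\<^sub>F x in at_top. ln (K * x) \<le> R x * exp (- (1 / b * ln x) - 2)"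
    unfolding R_def using \<open>1 / b < a\<close> pos by real_asymp
  have "128 * real k ^ 10 > 0" using assms by simp
  then have room: "\<forall>\<^sub>F x in at_top. 128 * real k ^ 10 * Q x * x ^ 4 \<le> x powr (5 + a) * ln x"
    unfolding Q_def using pos by real_asymp
  have y1: "\<forall>\<^sub>F x in at_top. x * (y x)\<^sup>2 \<le> 1" unfolding y_def using pos by real_asymp
  have y2: "\<forall>\<^sub>F x in at_top. y x \<le> 1 / 2" unfolding y_def using pos by real_asymp
  have "\<forall>\<^sub>F x in at_top. x > (1::real)" by (rule eventually_gt_at_top)
  with gap fail room y1 y2 have "\<forall>\<^sub>F x in at_top.
      R x + (real k + 1) \<le> Q x \<and> ln (K * x) \<le> R x * exp (- (1 / b * ln x) - 2) \<and>
      128 * real k ^ 10 * Q x * x ^ 4 \<le> x powr (5 + a) * ln x \<and> x * (y x)\<^sup>2 \<le> 1 \<and>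
      y x \<le> 1 / 2 \<and> x > 1"
    by eventually_elim blast
  from eventually_compose_filterlim[OF this filterlim_real_sequentially] show ?thesis
  proof (rule eventually_mono, elim conjE)
    fix \<Delta> :: nat
    define x where "x = real \<Delta>"
    assume "R (real \<Delta>) + (real k + 1) \<le> Q (real \<Delta>)"
      "ln (K * real \<Delta>) \<le> R (real \<Delta>) * exp (- (1 / b * ln (real \<Delta>)) - 2)"
      "128 * real k ^ 10 * Q (real \<Delta>) * real \<Delta> ^ 4 \<le> real \<Delta> powr (5 + a) * ln (real \<Delta>)"
      "real \<Delta> * (y (real \<Delta>))\<^sup>2 \<le> 1" "y (real \<Delta>) \<le> 1 / 2" "real \<Delta> > 1"
    note hyps = this[folded x_def]
    note x = hyps(6)
    define q where "q = nat \<lfloor>Q x\<rfloor> - k"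
    have L: "ln x > 0" using x by simp
    have R0: "R x > 0" unfolding R_def using x L pos by simp
    then have QR: "Q x > real k + 1" using hyps(1) by linarith
    then have "real (nat \<lfloor>Q x\<rfloor>) = of_int \<lfloor>Q x\<rfloor>" by simp
    then have fl: "real (nat \<lfloor>Q x\<rfloor>) \<le> Q x" "Q x - 1 < real (nat \<lfloor>Q x\<rfloor>)" by linarith+
    then have "real k < real (nat \<lfloor>Q x\<rfloor>)" using QR by linarith
    then have qk: "real (q + k) = real (nat \<lfloor>Q x\<rfloor>)" "q > 0" by (auto simp: q_def)
    then have qQ: "real (q + k) \<le> Q x" and Rq: "R x \<le> real q" using fl hyps(1) by linarith+
    have "real q ^ (k - 1) \<ge> R x ^ (k - 1)" using Rq R0 by (intro power_mono) auto
    moreover have "R x ^ (k - 1) = 1 / y x"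
    proof -
      have "R x ^ (k - 1) = R x powr m" using R0 by (simp add: m(2) powr_realpow)
      also have "\<dots> = b * (x / ln x)"
        using m L x pos by (simp add: R_def a_def powr_powr)
      finally show ?thesis by (simp add: y_def)
    qed
    moreover have y0: "y x > 0" using L x pos by (simp add: y_def)
    ultimately have "1 / y x \<le> real q ^ (k - 1)" by simp
    then have qy: "1 / real q ^ (k - 1) \<le> y x" using y0 qk(2) by (simp add: field_simps)
    define S where "S = (1 - 1 / real q ^ (k - 1)) ^ \<Delta>"
    have S1: "S \<le> 1" using qk(2) unfolding S_def by (intro power_le_one) (auto simp: divide_simps)
    have "exp (- (1 / b * ln x) - 2) = exp (- (real \<Delta> * y x) - 2)"
      using x pos by (simp add: y_def x_def)
    also have "\<dots> \<le> (1 - y x) ^ \<Delta>"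
      using y0 hyps(4,5) by (intro one_minus_power_ge) (auto simp: x_def)
    also have "\<dots> \<le> S" unfolding S_def using qy hyps(5) by (intro power_mono) auto
    finally have S: "exp (- (1 / b * ln x) - 2) \<le> S" .
    have "ln (K * x) \<le> R x * exp (- (1 / b * ln x) - 2)" by (rule hyps(2))
    also have "\<dots> \<le> real q * S" using Rq R0 S by (intro mult_mono) auto
    finally have KS: "ln (K * x) \<le> real q * S" .
    have "(1 - S) ^ q \<le> exp (- S) ^ q"
      using S1 exp_ge_add_one_self[of "- S"] by (intro power_mono) auto
    also have "\<dots> = exp (- (real q * S))" by (simp add: exp_of_nat_mult[symmetric])
    also have "\<dots> \<le> exp (- ln (K * x))" using KS by simp
    also have "\<dots> = 1 / (K * x)" using pos x by (simp add: exp_minus field_simps)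
    finally have fail: "(1 - S) ^ q \<le> 1 / (K * x)" .
    have "128 * real k ^ 10 * real q * x ^ 4 \<le> 128 * real k ^ 10 * Q x * x ^ 4"
      using qQ by (intro mult_right_mono mult_left_mono) auto
    then have "128 * real k ^ 10 * real q * x ^ 4 \<le> x powr (5 + a) * ln x"
      using hyps(3) by linarith
    then show "\<exists>q>0. real (q + k) \<le> ((real k - 1 + \<epsilon>) * (real \<Delta> / ln (real \<Delta>))) powr (1 / (real k - 1)) \<and>
        (1 - (1 - 1 / real q ^ (k - 1)) ^ \<Delta>) ^ q \<le> 1 / (8 * real k ^ 3 * real \<Delta>) \<and>
        128 * real k ^ 10 * real q * real \<Delta> ^ 4 \<le> real \<Delta> powr (5 + 1 / (real k - 1)) * ln (real \<Delta>)"
      using qk(2) qQ fail unfolding S_def Q_def K_def a_def m_def x_def by blast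
  qed
qed

text \<open>
  The repair needs the number of discarded vertices per part to be at most \<open>N / W\<close>. Half of this is
  allotted to the deviations of the class sizes, half to the vertices without available color; the
  constant in the lower bound on \<open>n\<close> comes from the former.
\<close>
lemma (in balanced_instance) balanced_coloring_exists_of_large_parts:
  assumes q: "q > 0" and \<Delta>: "\<Delta> \<ge> 1" and n: "n > 0"
    and fail: "(1 - (1 - 1 / real q ^ (k - 1)) ^ \<Delta>) ^ q \<le> 1 / (8 * real k ^ 3 * real \<Delta>)"
    and large: "128 * real k ^ 10 * real q * real \<Delta> ^ 4 \<le> real n"
  shows "\<exists>\<phi>. balanced_coloring k P V E (q + k) \<phi>"
proof -
  define x where "x = real \<Delta>"
  define \<kappa> where "\<kappa> = real k"
  define N where "N = real n"
  define W where "W = 2 * \<kappa> ^ 3 * x"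
  have pos: "x \<ge> 1" "\<kappa> \<ge> 1" "N > 0" using \<Delta> n k_ge_2 by (simp_all add: x_def \<kappa>_def N_def)
  then have W: "W > 0" by (simp add: W_def)
  have "\<kappa> \<le> \<kappa> ^ 3" using pos by (simp add: self_le_power)
  also have "\<kappa> ^ 3 \<le> \<kappa> ^ 3 * x" using pos by simp
  finally have W_ge: "\<kappa> + \<kappa> ^ 3 * x \<le> W" unfolding W_def by linarith
  have kx: "\<kappa> * x \<ge> 1" using mult_mono[of 1 \<kappa> 1 x] pos by simp
  have "\<kappa> * real q * (2 * (\<kappa> * N * (1 + \<kappa> * x)\<^sup>2)) \<le> \<kappa> * real q * (2 * (\<kappa> * N * (2 * (\<kappa> * x))\<^sup>2))"
    using pos kx by (intro mult_left_mono power_mono) auto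
  also have "\<dots> \<le> (N / (2 * W))\<^sup>2"
  proof -
    have "(\<kappa> * real q * (2 * (\<kappa> * N * (2 * (\<kappa> * x))\<^sup>2))) * (2 * W)\<^sup>2 = N * (128 * \<kappa> ^ 10 * real q * x ^ 4)"
      by (simp add: W_def power_mult_distrib eval_nat_numeral)
    also have "\<dots> \<le> N * N"
      using large pos by (intro mult_left_mono) (auto simp: x_def N_def \<kappa>_def)
    finally show ?thesis using W by (simp add: power_divide pos_le_divide_eq power2_eq_square[of N])
  qed
  finally have sqrt_le: "sqrt (\<kappa> * real q * (2 * (\<kappa> * N * (1 + \<kappa> * x)\<^sup>2))) \<le> N / (2 * W)"
    using W pos by (intro real_le_lsqrt) auto
  have "2 * (N * (1 / (8 * \<kappa> ^ 3 * x))) = N / (2 * W)" by (simp add: W_def)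
  with sqrt_le have "(sqrt (\<kappa> * real q * (2 * (\<kappa> * N * (1 + \<kappa> * x)\<^sup>2))) + 2 * (N * (1 / (8 * \<kappa> ^ 3 * x)))) * (\<kappa> + \<kappa> ^ 3 * x)
      \<le> (N / (2 * W) + N / (2 * W)) * W"
    using W_ge W pos by (intro mult_mono) auto
  also have "\<dots> = N" using W by simp
  finally show ?thesis
    using q n fail pos by (intro balanced_coloring_exists[where p = "1 / (8 * \<kappa> ^ 3 * x)"])
      (auto simp: x_def N_def \<kappa>_def)
qed

theorem theorem1p7:
  fixes \<epsilon> :: real and k :: nat
  assumes "\<epsilon> > 0" and "k \<ge> 2"
  shows "\<exists>C::real. C > 0 \<and>
    (\<exists>\<Delta>\<^sub>0::nat. \<forall>\<Delta>::nat. \<Delta> \<ge> \<Delta>\<^sub>0 \<longrightarrow>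
      (\<forall>(n::nat) (P :: nat \<Rightarrow> 'a set) (V :: 'a set) (E :: 'a set set).
        real n \<ge> C * real \<Delta> powr (5 + 1 / (real k - 1)) * ln (real \<Delta>) \<longrightarrow>
        balanced_partite_hypergraph n k P V E \<longrightarrow>
        max_degree V E = \<Delta> \<longrightarrow>
        ereal_of_enat (balanced_chromatic_number k P V E) \<le>
          ereal (((real k - 1 + \<epsilon>) * (real \<Delta> / ln (real \<Delta>))) powr (1 / (real k - 1)))))"
proof -
  from eventually_number_of_colors[OF assms] obtain \<Delta>\<^sub>0 where colors: "\<And>\<Delta>. \<Delta> \<ge> \<Delta>\<^sub>0 \<Longrightarrow> \<exists>q>0.
      real (q + k) \<le> ((real k - 1 + \<epsilon>) * (real \<Delta> / ln (real \<Delta>))) powr (1 / (real k - 1)) \<and>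
      (1 - (1 - 1 / real q ^ (k - 1)) ^ \<Delta>) ^ q \<le> 1 / (8 * real k ^ 3 * real \<Delta>) \<and>
      128 * real k ^ 10 * real q * real \<Delta> ^ 4 \<le> real \<Delta> powr (5 + 1 / (real k - 1)) * ln (real \<Delta>)"
    by (auto simp: eventually_sequentially)
  show ?thesis
  proof (rule exI[of _ 1], intro conjI exI[of _ "max \<Delta>\<^sub>0 1"] allI impI)
    fix \<Delta> n :: nat and P :: "nat \<Rightarrow> 'a set" and V :: "'a set" and E :: "'a set set"
    assume "max \<Delta>\<^sub>0 1 \<le> \<Delta>"
      and n: "1 * real \<Delta> powr (5 + 1 / (real k - 1)) * ln (real \<Delta>) \<le> real n"
      and H: "balanced_partite_hypergraph n k P V E" and deg: "max_degree V E = \<Delta>"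
    then have \<Delta>: "\<Delta> \<ge> \<Delta>\<^sub>0" "\<Delta> \<ge> 1" by simp_all
    from colors[OF \<Delta>(1)] obtain q where q: "q > 0"
      "real (q + k) \<le> ((real k - 1 + \<epsilon>) * (real \<Delta> / ln (real \<Delta>))) powr (1 / (real k - 1))"
      "(1 - (1 - 1 / real q ^ (k - 1)) ^ \<Delta>) ^ q \<le> 1 / (8 * real k ^ 3 * real \<Delta>)"
      "128 * real k ^ 10 * real q * real \<Delta> ^ 4 \<le> real \<Delta> powr (5 + 1 / (real k - 1)) * ln (real \<Delta>)"
      by blast
    have "finite V"
      using H unfolding balanced_partite_hypergraph_def partite_hypergraph_def
        uniform_hypergraph_def hypergraph_def by blast
    then have "vertex_degree E v \<le> \<Delta>" if "v \<in> V" for v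
      using that deg by (auto simp: max_degree_def)
    then interpret balanced_instance n k \<Delta> P V E
      using H assms(2) by unfold_locales
    have large: "128 * real k ^ 10 * real q * real \<Delta> ^ 4 \<le> real n" using q(4) n by linarith
    moreover have "128 * real k ^ 10 * real q * real \<Delta> ^ 4 > 0" using q(1) \<Delta>(2) k_ge_2 by simp
    ultimately have "n > 0" by linarith
    with large obtain \<phi> where \<phi>: "balanced_coloring k P V E (q + k) \<phi>"
      using balanced_coloring_exists_of_large_parts q(1,3) \<Delta>(2) by blast
    have "balanced_chromatic_number k P V E \<le> enat (q + k)"
      unfolding balanced_chromatic_number_def using \<phi> by (intro Inf_lower) blast
    then have "ereal_of_enat (balanced_chromatic_number k P V E) \<le> ereal_of_enat (enat (q + k))"
      by (simp only: ereal_of_enat_le_iff)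
    also have "\<dots> \<le> ereal (((real k - 1 + \<epsilon>) * (real \<Delta> / ln (real \<Delta>))) powr (1 / (real k - 1)))"
      using q(2) by simp
    finally show "ereal_of_enat (balanced_chromatic_number k P V E) \<le>
        ereal (((real k - 1 + \<epsilon>) * (real \<Delta> / ln (real \<Delta>))) powr (1 / (real k - 1)))" .
  qed simp
qed

end
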